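(* Consider the intraday planning problem (ID) described in the context, and suppose that its data satisfy the standing numerical and economic conditions (i)--(v) listed in the context. Then (ID) is a convex quadratic program. More precisely, with the stacked variable $v=\operatorname{col}((x_i)_{i\in\mathcal N},(z_a)_{a\in\mathcal N})\in\mathbb R^{\sum_{i\in\mathcal N}n_i+NHM}$, problem (ID) is represented (the objective being equal up to an additive constant independent of $v$) by $$\min_v\ \tfrac12 v^\top Qv+q^\top v\quad\text{s.t.}\quad A_{\mathrm{eq}}v=b_{\mathrm{eq}},\quad A_{\mathrm{in}}v\le b_{\mathrm{in}},$$ where $Q=Q^\top\succeq0$, $Q=\operatorname{blkdiag}(Q_1,\dots,Q_N,\mathbf 0_{NHM\times NHM})$, $q=\operatorname{col}(q_1,\dots,q_N,\mathbf 0_{NHM})$, and $A_{\mathrm{eq}},b_{\mathrm{eq}},A_{\mathrm{in}},b_{\mathrm{in}},Q_i,q_i$ are the explicit matrices and vectors given in the context. Moreover, if $\varepsilon_i>0$ for every $i\in\mathcal N$, then each local Hessian block $Q_i$ is positive definite.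
   Context: **Network and index sets.** $(\mathcal N,\mathcal E)$ is a finite graph, $\mathcal N=\{1,\dots,N\}$ (control areas), $\mathcal E\subset\mathcal N\times\mathcal N$ (lines), each line stored once with a fixed orientation $e=(\mathrm{from}(e),\mathrm{to}(e))$; there are no self-loops and at most one line joins two areas. $\mathcal N_i$ is the set of neighbours of $i$, $K_i=|\mathcal N_i|$ (also the number of lines incident on $i$). For $e$ incident on $i$ (written $e\ni i$), $\sigma_{i,e}=+1$ if $i=\mathrm{from}(e)$ and $\sigma_{i,e}=-1$ if $i=\mathrm{to}(e)$. $\mathcal I,\mathcal B,\mathcal R\subseteq\mathcal N$ are the areas having, respectively, a converter plant, a battery, and renewable injection. $\mathcal G$ is a finite set of generating units with a placement map $\mathcal G\to\mathcal N$; $\mathcal G_i$ is the set of units placed at $i$. $H,M\ge1$ are integers, $\mathcal T=\{0,\dots,H-1\}$ (stages), $\mathcal T_E=\{0,\dots,H\}$, $\mathcal M=\{1,\dots,M\}$ (scenarios), with probabilities $\pi_m>0$, $\sum_m\pi_m=1$. $\Delta_{\mathrm{ID}}=\tfrac14$ (hours). Variables of absent assets are omitted (and count as zero in sums); constraints and costs of absent assets are omitted. **Fixed data.** Real numbers: $P^{\mathrm{mot}}_i(t,m),P^{\mathrm{av}}_i(t,m),P^{\mathrm{res,max}}_i(t,m)\ge0$; unit envelopes $\overline P^{\mathrm g}_g(t,m),\overline P^{\mathrm p}_g(t,m)$; all scenario data at $t=0$ do not depend on $m$. Lines: $B_e>0$, $\bar P_e>0$, and loss-cut coefficients $a_{e,\kappa},b_{e,\kappa}\in\mathbb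 R$, $\kappa=1,\dots,K_\ell$. Batteries: $\underline E_i,\overline E_i,\overline P^{\mathrm b}_i,E^0_i,E^{\mathrm{term}}_i$, $\eta^{\mathrm c}_i,\eta^{\mathrm d}_i\in(0,1]$, references $E^{\mathrm{ref}}_i(t+1)$. Converters: $\underline P^{\mathrm{cv}}_i,\overline P^{\mathrm{cv}}_i,\Delta\overline P^{\mathrm{cv}}_i,p^{\mathrm{conv,prev}}_{i,n}$, peak targets $\bar p^{\mathrm{DA}}_i$, frozen commitments $\delta^{\mathrm{DA}}_i(h)\in\{0,1\}$ for day-ahead hours $h$ in a finite set $\mathcal H^{\mathrm{DA}}$, a map $h_n:\mathcal T\to\mathcal H^{\mathrm{DA}}$ giving the hour containing stage $t$, cleared energies $e^{\mathrm{DA}}_i(h)$ and already delivered energies $e^{\mathrm{past}}_{i,h}(n)$; $G_{n,h}=\{t\in\mathcal T:h_n(t)=h\}$. Costs: $c^{\mathrm g}_g(t),c^{\mathrm p}_g(t),a_g(t),c^{\mathrm b}_i,c^{\mathrm{ct}}_i,c^{\mathrm{rg}}_i,c^{\mathrm{pk}},w^{\mathrm{soc}}_i,\varepsilon_i\ge0$, $c^{\mathrm{ls}}>0$, and signed prices $c^E_i(t),c^{E,\mathrm x}_i(t)\in\mathbb R$. **Variables of area $i$**, collected in $x_i\in\mathbb R^{n_i}$ ($n_i$ = number of scalar coordinates), for all $(t,m)\in\mathcal T\times\mathcal M$ unless indicated: $p^{\mathrm{conv}}_i,q_i^+,q_i^-$ and $s^{\mathrm{pk}}_i(m)$ (if $i\in\mathcal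 I$; $s_i^{\mathrm{pk}}$ has one entry per scenario); $p^{\mathrm c}_i,p^{\mathrm d}_i$ and $E_i(s,m)$, $s\in\mathcal T_E$ (if $i\in\mathcal B$); $p^{\mathrm{res}}_i$ (if $i\in\mathcal R$); $p^{\mathrm g}_g,p^{\mathrm{pump}}_g$ for $g\in\mathcal G_i$; $p^{\mathrm{reg}}_i$; own angle $\theta_{i,i}$; flow copies $p^{\mathrm{flow}}_{e,i}$ for $e\ni i$; neighbour-angle copies $\theta_{j,i}$ for $j\in\mathcal N_i$; $\ell_e$ for lines with $\mathrm{from}(e)=i$. **Local feasible set $\mathcal X_i$**: all $x_i$ satisfying, for all applicable indices, (1) $0\le p^{\mathrm{reg}}_i\le P^{\mathrm{av}}_i$; (2) $p^{\mathrm{conv}}_i+\sum_{g\in\mathcal G_i}(p^{\mathrm g}_g-p^{\mathrm{pump}}_g)+p^{\mathrm d}_i-p^{\mathrm c}_i+p^{\mathrm{res}}_i+p^{\mathrm{reg}}_i-\sum_{e\ni i}\sigma_{i,e}p^{\mathrm{flow}}_{e,i}=P^{\mathrm{mot}}_i$; (3) $p^{\mathrm{flow}}_{e,i}=\sigma_{i,e}B_e(\theta_{i,i}-\theta_{j,i})$ for $e$ joining $i$ and $j$, and $|p^{\mathrm{flow}}_{e,i}|\le\bar P_e$; (4) $\ell_e\ge a_{e,\kappa}p^{\mathrm{flow}}_{e,i}+b_{e,\kappa}$ for $i=\mathrm{from}(e)$, $\kappa=1,\dots,K_\ell$; (5) $E_i(0,m)=E_i^0$, $E_i(t+1,m)=E_i(t,m)+\Delta_{\mathrm{ID}}(\eta^{\mathrm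 c}_ip^{\mathrm c}_i-p^{\mathrm d}_i/\eta^{\mathrm d}_i)$, $\underline E_i\le E_i(s,m)\le\overline E_i$ ($s\in\mathcal T_E$), $0\le p^{\mathrm c}_i,p^{\mathrm d}_i\le\overline P^{\mathrm b}_i$, $E_i(H,m)\ge E^{\mathrm{term}}_i$; (6) $p^{\mathrm{conv}}_i=q_i^+-q_i^-$, $q_i^\pm\ge0$, $\delta^{\mathrm{DA}}_i(h_n(t))\underline P^{\mathrm{cv}}_i\le p^{\mathrm{conv}}_i(t,m)\le\delta^{\mathrm{DA}}_i(h_n(t))\overline P^{\mathrm{cv}}_i$, $|p^{\mathrm{conv}}_i(0,m)-p^{\mathrm{conv,prev}}_{i,n}|\le\Delta\overline P^{\mathrm{cv}}_i$, $|p^{\mathrm{conv}}_i(t,m)-p^{\mathrm{conv}}_i(t-1,m)|\le\Delta\overline P^{\mathrm{cv}}_i$ ($t\ge1$); (7) $0\le p^{\mathrm g}_g\le\overline P^{\mathrm g}_g$, $0\le p^{\mathrm{pump}}_g\le\overline P^{\mathrm p}_g$; (8) $0\le p^{\mathrm{res}}_i\le P^{\mathrm{res,max}}_i$; (9) $s^{\mathrm{pk}}_i(m)\ge q_i^+(t,m)-\bar p^{\mathrm{DA}}_i$ for all $t$, $s^{\mathrm{pk}}_i(m)\ge0$; (10) $\Delta_{\mathrm{ID}}\sum_{t\in G_{n,h}}p^{\mathrm{conv}}_i(t,m)=e^{\mathrm{DA}}_i(h)-e^{\mathrm{past}}_{i,h}(n)$ for every $m$ and every gate-closed hour $h$ (from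 a given set of hours) with $G_{n,h}\neq\emptyset$ whose remaining quarter-hours all lie in the horizon; (11) $u_i(0,m)=u_i(0,m')$ for all $m,m'$, where $u_i(t,m)=\operatorname{col}(p^{\mathrm{conv}}_i,p^{\mathrm c}_i,p^{\mathrm d}_i,p^{\mathrm{res}}_i,p^{\mathrm{reg}}_i,(p^{\mathrm g}_g,p^{\mathrm{pump}}_g)_{g\in\mathcal G_i})(t,m)$. **Objective.** With $\ell_i(t,m)=\Delta_{\mathrm{ID}}(c^E_iq_i^+-c^{E,\mathrm x}_iq_i^-)+\Delta_{\mathrm{ID}}c^{\mathrm b}_i(p^{\mathrm c}_i+p^{\mathrm d}_i)+\Delta_{\mathrm{ID}}c^{\mathrm{ct}}_i(P^{\mathrm{res,max}}_i-p^{\mathrm{res}}_i)+c^{\mathrm{pk}}s^{\mathrm{pk}}_i(m)+\Delta_{\mathrm{ID}}c^{\mathrm{rg}}_i(P^{\mathrm{av}}_i-p^{\mathrm{reg}}_i)+\Delta_{\mathrm{ID}}\sum_{g\in\mathcal G_i}[c^{\mathrm g}_gp^{\mathrm g}_g+c^{\mathrm p}_gp^{\mathrm{pump}}_g+\tfrac{a_g}{2}(p^{\mathrm g}_g-p^{\mathrm{pump}}_g)^2]$ (arguments $t$ or $(t,m)$ suppressed), set $$f_i(x_i)=\sum_m\pi_m\sum_{t\in\mathcal T}\Big(\ell_i(t,m)+\sum_{e:\,i=\mathrm{from}(e)}c^{\mathrm{ls}}\ell_e(t,m)\Delta_{\mathrm{ID}}\Big)+\frac{w^{\mathrm{soc}}_i}{2}\sum_m\pi_m\sum_{t\in\mathcal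 T}(E_i(t+1,m)-E^{\mathrm{ref}}_i(t+1))^2+\frac{\varepsilon_i}{2}\|x_i\|^2 .$$ **Problem (ID).** For $a\in\{i\}\cup\mathcal N_i$ let $S_i^{(a)}\in\{0,1\}^{HM\times n_i}$ select the block $\theta_{a,i}\in\mathbb R^{HM}$ of $x_i$. Fix a reference area $r$. (ID) is: minimize $\sum_{i\in\mathcal N}f_i(x_i)$ over $\{x_i\}$ and $z_a\in\mathbb R^{HM}$ ($a\in\mathcal N$) subject to $x_i\in\mathcal X_i$, $S_i^{(a)}x_i=z_a$ for all $i\in\mathcal N$, $a\in\{i\}\cup\mathcal N_i$, and $z_r=0$. **Standing conditions.** (i) The graph is finite and connected, $H,M,K_\ell$ are positive integers, $B_e,\bar P_e\in(0,\infty)$. (ii) $0\le\underline E_i\le\overline E_i<\infty$, $\overline P^{\mathrm b}_i\in[0,\infty)$, $\eta^{\mathrm c}_i,\eta^{\mathrm d}_i\in(0,1]$, $E_i^0,E_i^{\mathrm{term}}\in\mathbb R$ for $i\in\mathcal B$; $-\infty<\underline P^{\mathrm{cv}}_i\le0\le\overline P^{\mathrm{cv}}_i<\infty$, $\Delta\overline P^{\mathrm{cv}}_i\in[0,\infty)$, $p^{\mathrm{conv,prev}}_{i,n}\in\mathbb R$ for $i\in\mathcal I$. (iii) $P^{\mathrm{mot}}_i,P^{\mathrm{av}}_i,P^{\mathrm{res,max}}_i,\overline P^{\mathrm g}_g,\overline P^{\mathrm p}_g$ take values in $[0,\infty)$. (iv) $\delta^{\mathrm{DA}}_i(h)\in\{0,1\}$,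 $\bar p^{\mathrm{DA}}_i\in[0,\infty)$, all other day-ahead quantities, $e^{\mathrm{past}}_{i,h}(n)$, $E^{\mathrm{ref}}_i(t+1)$, $a_{e,\kappa},b_{e,\kappa}$ are real, and $h_n(t)\in\mathcal H^{\mathrm{DA}}$. (v) $\pi_m\in(0,1]$, $\sum_m\pi_m=1$; $c^{\mathrm g}_g,c^{\mathrm p}_g,a_g,c^{\mathrm b}_i,c^{\mathrm{ct}}_i,c^{\mathrm{rg}}_i,w^{\mathrm{soc}}_i,c^{\mathrm{pk}},\varepsilon_i\in[0,\infty)$, $c^{\mathrm{ls}}\in(0,\infty)$, $c^E_i(t),c^{E,\mathrm x}_i(t)\in\mathbb R$ with $c^E_i(t)>c^{E,\mathrm x}_i(t)$ for $i\in\mathcal I,t\in\mathcal T$. All data are fixed. **Explicit matrices.** For a scalar coordinate $y$ of $x_i$ let $R_i[y]\in\{0,1\}^{1\times n_i}$ be the row with $R_i[y]x_i=y$ (zero for an absent asset inside a sum); let $U_i(t,m)x_i=u_i(t,m)$. Arguments $(t,m)$ are suppressed when clear. $A_{i,\mathrm{eq}},b_{i,\mathrm{eq}}$ stack, for all applicable indices, coefficient rows $|$ right-hand sides: - $R_i[p^{\mathrm{conv}}_i]+R_i[p^{\mathrm d}_i]-R_i[p^{\mathrm c}_i]+R_i[p^{\mathrm{res}}_i]+R_i[p^{\mathrm{reg}}_i]+\sum_{g\in\mathcal G_i}(R_i[p^{\mathrm g}_g]-R_i[p^{\mathrm{pump}}_g])-\sum_{e\ni i}\sigma_{i,e}R_i[p^{\mathrm{flow}}_{e,i}]$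 $|$ $P^{\mathrm{mot}}_i(t,m)$; - $R_i[p^{\mathrm{flow}}_{e,i}]-\sigma_{i,e}B_e(R_i[\theta_{i,i}]-R_i[\theta_{j,i}])$ $|$ $0$ ($e$ joining $i,j$); - $R_i[E_i(t+1,m)]-R_i[E_i(t,m)]-\Delta_{\mathrm{ID}}\eta^{\mathrm c}_iR_i[p^{\mathrm c}_i]+\Delta_{\mathrm{ID}}(\eta^{\mathrm d}_i)^{-1}R_i[p^{\mathrm d}_i]$ $|$ $0$; - $R_i[E_i(0,m)]$ $|$ $E_i^0$; - $R_i[p^{\mathrm{conv}}_i]-R_i[q_i^+]+R_i[q_i^-]$ $|$ $0$; - $\Delta_{\mathrm{ID}}\sum_{t\in G_{n,h}}R_i[p^{\mathrm{conv}}_i(t,m)]$ $|$ $e^{\mathrm{DA}}_i(h)-e^{\mathrm{past}}_{i,h}(n)$ (hours $h$ of constraint (10)); - $U_i(0,m)-U_i(0,1)$, $m=2,\dots,M$ $|$ $0$. $A_{i,\mathrm{in}},b_{i,\mathrm{in}}$ stack: for each fixed coordinate bound $\underline y\le y\le\overline y$ among (1), the line limits in (3), the boxes in (5), the sign and commitment bounds in (6), (7), (8), and $s^{\mathrm{pk}}_i(m)\ge0$, the rows $-R_i[y]$ $|$ $-\underline y$ and $R_i[y]$ $|$ $\overline y$ (a missing or infinite endpoint gives no row); and - $-R_i[E_i(H,m)]$ $|$ $-E_i^{\mathrm{term}}$; - $\zeta R_i[p^{\mathrm{conv}}_i(0,m)]$ $|$ $\Delta\overline P^{\mathrm{cv}}_i+\zeta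 p^{\mathrm{conv,prev}}_{i,n}$, $\zeta\in\{-1,1\}$; - $\zeta(R_i[p^{\mathrm{conv}}_i(t,m)]-R_i[p^{\mathrm{conv}}_i(t-1,m)])$ $|$ $\Delta\overline P^{\mathrm{cv}}_i$, $t\ge1$, $\zeta\in\{-1,1\}$; - $R_i[q_i^+]-R_i[s^{\mathrm{pk}}_i(m)]$ $|$ $\bar p^{\mathrm{DA}}_i$; - $a_{e,\kappa}R_i[p^{\mathrm{flow}}_{e,i}]-R_i[\ell_e]$ $|$ $-b_{e,\kappa}$ ($i=\mathrm{from}(e)$). Let $\widehat S_i=\operatorname{col}_{a\in\{i\}\cup\mathcal N_i}S_i^{(a)}$, $\widehat S=\operatorname{blkdiag}_i\widehat S_i$, $Z_a=\mathbf e_a^\top\otimes I_{HM}$ (so $Z_a$ selects $z_a$ from $\operatorname{col}_az_a$), $\widehat Z=\operatorname{col}_{i,\,a\in\{i\}\cup\mathcal N_i}Z_a$ in the row order of $\widehat S$, $D_{\mathrm{eq}}=\operatorname{blkdiag}_iA_{i,\mathrm{eq}}$, $D_{\mathrm{in}}=\operatorname{blkdiag}_iA_{i,\mathrm{in}}$, $p=HM\sum_i(1+K_i)$. Then $$A_{\mathrm{eq}}=\begin{bmatrix}D_{\mathrm{eq}}&\mathbf 0\\ \widehat S&-\widehat Z\\ \mathbf 0&Z_r\end{bmatrix},\quad b_{\mathrm{eq}}=\operatorname{col}((b_{i,\mathrm{eq}})_i,\mathbf 0_p,\mathbf 0_{HM}),\quad A_{\mathrm{in}}=[D_{\mathrm{in}}\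 \ \mathbf 0],\quad b_{\mathrm{in}}=\operatorname{col}_ib_{i,\mathrm{in}}.$$ With $D_{ig}(t,m)=R_i[p^{\mathrm g}_g(t,m)]-R_i[p^{\mathrm{pump}}_g(t,m)]$, $$Q_i=\varepsilon_iI_{n_i}+\sum_m\pi_m\sum_{t\in\mathcal T}\Big[w^{\mathrm{soc}}_iR_i[E_i(t+1,m)]^\top R_i[E_i(t+1,m)]+\Delta_{\mathrm{ID}}\sum_{g\in\mathcal G_i}a_g(t)D_{ig}(t,m)^\top D_{ig}(t,m)\Big],$$ $$\begin{aligned}q_i={}&\sum_m\pi_m\sum_{t\in\mathcal T}\Big\{\Delta_{\mathrm{ID}}\Big[c^E_i(t)R_i[q_i^+]-c^{E,\mathrm x}_i(t)R_i[q_i^-]+c^{\mathrm b}_i(R_i[p^{\mathrm c}_i]+R_i[p^{\mathrm d}_i])-c^{\mathrm{ct}}_iR_i[p^{\mathrm{res}}_i]-c^{\mathrm{rg}}_iR_i[p^{\mathrm{reg}}_i]\\&+\sum_{g\in\mathcal G_i}(c^{\mathrm g}_g(t)R_i[p^{\mathrm g}_g]+c^{\mathrm p}_g(t)R_i[p^{\mathrm{pump}}_g])+c^{\mathrm{ls}}\sum_{e:\,i=\mathrm{from}(e)}R_i[\ell_e]\Big]-w^{\mathrm{soc}}_iE^{\mathrm{ref}}_i(t+1)R_i[E_i(t+1,m)]\Big\}^\top\\&+Hc^{\mathrm{pk}}\sum_m\pi_mR_i[s^{\mathrm{pk}}_i(m)]^\top.\end{aligned}$$ Terms of absent assets are omitted.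 *)

theory Defs
  imports Complex_Main "HOL-Library.FuncSet" "Jordan_Normal_Form.Matrix"
begin

section \<open>Problem data\<close>

text \<open>
  Areas are \<open>1,\<dots>,N\<close>, scenarios \<open>1,\<dots>,M\<close>, stages \<open>0,\<dots>,H-1\<close>. A line is the ordered pair
  (from, to). Arguments come in the order area/unit/line, stage or hour, scenario.

  \<open>hour_of t\<close> is the day-ahead hour that contains the quarter-hour lying \<open>t\<close> quarter-hours ahead.
  Its values for \<open>t < H\<close> are the map \<open>h\<^sub>n\<close>; its values for \<open>t \<ge> H\<close> are used only to say which
  hours have all their remaining quarter-hours inside the horizon.
\<close>

record 'g id_data =
  n_areas :: nat
  lines :: "(nat \<times> nat) set"
  conv_areas :: "nat set"
  batt_areas :: "nat set"
  ren_areas :: "nat set"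
  units :: "'g set"
  place :: "'g \<Rightarrow> nat"
  horizon :: nat
  n_scen :: nat
  prob :: "nat \<Rightarrow> real"
  ref_area :: nat
  P_mot :: "nat \<Rightarrow> nat \<Rightarrow> nat \<Rightarrow> real"
  P_av :: "nat \<Rightarrow> nat \<Rightarrow> nat \<Rightarrow> real"
  P_resmax :: "nat \<Rightarrow> nat \<Rightarrow> nat \<Rightarrow> real"
  P_gmax :: "'g \<Rightarrow> nat \<Rightarrow> nat \<Rightarrow> real"
  P_pmax :: "'g \<Rightarrow> nat \<Rightarrow> nat \<Rightarrow> real"
  line_B :: "nat \<times> nat \<Rightarrow> real"
  line_P :: "nat \<times> nat \<Rightarrow> real"
  n_cuts :: nat
  cut_a :: "nat \<times> nat \<Rightarrow> nat \<Rightarrow> real"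
  cut_b :: "nat \<times> nat \<Rightarrow> nat \<Rightarrow> real"
  E_min :: "nat \<Rightarrow> real"
  E_max :: "nat \<Rightarrow> real"
  P_bmax :: "nat \<Rightarrow> real"
  E_init :: "nat \<Rightarrow> real"
  E_term :: "nat \<Rightarrow> real"
  eta_c :: "nat \<Rightarrow> real"
  eta_d :: "nat \<Rightarrow> real"
  E_ref :: "nat \<Rightarrow> nat \<Rightarrow> real"
  P_cvmin :: "nat \<Rightarrow> real"
  P_cvmax :: "nat \<Rightarrow> real"
  P_ramp :: "nat \<Rightarrow> real"
  p_prev :: "nat \<Rightarrow> real"
  p_peak :: "nat \<Rightarrow> real"
  da_hours :: "nat set"
  delta_DA :: "nat \<Rightarrow> nat \<Rightarrow> real"
  hour_of :: "nat \<Rightarrow> nat"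
  closed_hours :: "nat set"
  e_DA :: "nat \<Rightarrow> nat \<Rightarrow> real"
  e_past :: "nat \<Rightarrow> nat \<Rightarrow> real"
  cost_g :: "'g \<Rightarrow> nat \<Rightarrow> real"
  cost_p :: "'g \<Rightarrow> nat \<Rightarrow> real"
  cost_a :: "'g \<Rightarrow> nat \<Rightarrow> real"
  cost_b :: "nat \<Rightarrow> real"
  cost_ct :: "nat \<Rightarrow> real"
  cost_rg :: "nat \<Rightarrow> real"
  cost_pk :: real
  cost_ls :: real
  w_soc :: "nat \<Rightarrow> real"
  eps :: "nat \<Rightarrow> real"
  price_E :: "nat \<Rightarrow> nat \<Rightarrow> real"
  price_Ex :: "nat \<Rightarrow> nat \<Rightarrow> real"

definition dt :: real where "dt = 1 / 4"

definition areas :: "'g id_data \<Rightarrow> nat set" where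
  "areas D = {1..n_areas D}"

definition area_list :: "'g id_data \<Rightarrow> nat list" where
  "area_list D = [1..<Suc (n_areas D)]"

definition stages :: "'g id_data \<Rightarrow> nat set" where
  "stages D = {0..<horizon D}"

definition scens :: "'g id_data \<Rightarrow> nat set" where
  "scens D = {1..n_scen D}"

definition scen_list :: "'g id_data \<Rightarrow> nat list" where
  "scen_list D = [1..<Suc (n_scen D)]"

definition tm_list :: "'g id_data \<Rightarrow> (nat \<times> nat) list" where
  "tm_list D = List.product [0..<horizon D] (scen_list D)"

definition HM :: "'g id_data \<Rightarrow> nat" where
  "HM D = horizon D * n_scen D"

definition nbrs :: "'g id_data \<Rightarrow> nat \<Rightarrow> nat set" where
  "nbrs D i = {j. (i, j) \<in> lines D \<or> (j, i) \<in> lines D}"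

definition nbr_list :: "'g id_data \<Rightarrow> nat \<Rightarrow> nat list" where
  "nbr_list D i = sorted_list_of_set (nbrs D i)"

definition inc_lines :: "'g id_data \<Rightarrow> nat \<Rightarrow> (nat \<times> nat) set" where
  "inc_lines D i = {e \<in> lines D. fst e = i \<or> snd e = i}"

definition out_lines :: "'g id_data \<Rightarrow> nat \<Rightarrow> (nat \<times> nat) set" where
  "out_lines D i = {e \<in> lines D. fst e = i}"

text \<open>The lines at \<open>i\<close>, enumerated in the order of the neighbours of \<open>i\<close>.\<close>

definition inc_list :: "'g id_data \<Rightarrow> nat \<Rightarrow> (nat \<times> nat) list" where
  "inc_list D i = map (\<lambda>j. if (i, j) \<in> lines D then (i, j) else (j, i)) (nbr_list D i)"

definition out_list :: "'g id_data \<Rightarrow> nat \<Rightarrow> (nat \<times> nat) list" where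
  "out_list D i = filter (\<lambda>e. fst e = i) (inc_list D i)"

definition line_sgn :: "nat \<Rightarrow> nat \<times> nat \<Rightarrow> real" where
  "line_sgn i e = (if i = fst e then 1 else - 1)"

definition other_end :: "nat \<Rightarrow> nat \<times> nat \<Rightarrow> nat" where
  "other_end i e = (if i = fst e then snd e else fst e)"

definition units_at :: "'g id_data \<Rightarrow> nat \<Rightarrow> 'g set" where
  "units_at D i = {g \<in> units D. place D g = i}"

definition unit_list :: "('g::linorder) id_data \<Rightarrow> nat \<Rightarrow> 'g list" where
  "unit_list D i = sorted_list_of_set (units_at D i)"

definition hour_stages :: "'g id_data \<Rightarrow> nat \<Rightarrow> nat set" where
  "hour_stages D h = {t \<in> stages D. hour_of D t = h}"

text \<open>The hours at which the energy-delivery equality is imposed.\<close>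

definition energy_hours :: "'g id_data \<Rightarrow> nat set" where
  "energy_hours D = {h \<in> closed_hours D. hour_stages D h \<noteq> {} \<and> {t. hour_of D t = h} \<subseteq> stages D}"


section \<open>Standing conditions\<close>

definition graph_conditions :: "'g id_data \<Rightarrow> bool" where
  "graph_conditions D \<longleftrightarrow>
     lines D \<subseteq> areas D \<times> areas D \<and>
     (\<forall>i j. (i, j) \<in> lines D \<longrightarrow> i \<noteq> j \<and> (j, i) \<notin> lines D) \<and>
     (\<forall>i\<in>areas D. \<forall>j\<in>areas D. (i, j) \<in> (lines D \<union> (lines D)\<inverse>)\<^sup>*) \<and>
     ref_area D \<in> areas D \<and>
     conv_areas D \<subseteq> areas D \<and> batt_areas D \<subseteq> areas D \<and> ren_areas D \<subseteq> areas D \<and>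
     finite (units D) \<and> place D ` units D \<subseteq> areas D \<and>
     horizon D \<ge> 1 \<and> n_scen D \<ge> 1 \<and> n_cuts D \<ge> 1 \<and>
     (\<forall>e\<in>lines D. line_B D e > 0 \<and> line_P D e > 0)"

definition device_conditions :: "'g id_data \<Rightarrow> bool" where
  "device_conditions D \<longleftrightarrow>
     (\<forall>i\<in>batt_areas D. 0 \<le> E_min D i \<and> E_min D i \<le> E_max D i \<and> 0 \<le> P_bmax D i \<and>
        0 < eta_c D i \<and> eta_c D i \<le> 1 \<and> 0 < eta_d D i \<and> eta_d D i \<le> 1) \<and>
     (\<forall>i\<in>conv_areas D. P_cvmin D i \<le> 0 \<and> 0 \<le> P_cvmax D i \<and> 0 \<le> P_ramp D i)"

definition scenario_conditions :: "'g id_data \<Rightarrow> bool" where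
  "scenario_conditions D \<longleftrightarrow>
     (\<forall>t\<in>stages D. \<forall>m\<in>scens D.
        (\<forall>i\<in>areas D. 0 \<le> P_mot D i t m \<and> 0 \<le> P_av D i t m) \<and>
        (\<forall>i\<in>ren_areas D. 0 \<le> P_resmax D i t m) \<and>
        (\<forall>g\<in>units D. 0 \<le> P_gmax D g t m \<and> 0 \<le> P_pmax D g t m)) \<and>
     (\<forall>m\<in>scens D. \<forall>m'\<in>scens D.
        (\<forall>i\<in>areas D. P_mot D i 0 m = P_mot D i 0 m' \<and> P_av D i 0 m = P_av D i 0 m') \<and>
        (\<forall>i\<in>ren_areas D. P_resmax D i 0 m = P_resmax D i 0 m') \<and>
        (\<forall>g\<in>units D. P_gmax D g 0 m = P_gmax D g 0 m' \<and> P_pmax D g 0 m = P_pmax D g 0 m'))"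

definition day_ahead_conditions :: "'g id_data \<Rightarrow> bool" where
  "day_ahead_conditions D \<longleftrightarrow>
     finite (da_hours D) \<and> (\<forall>t\<in>stages D. hour_of D t \<in> da_hours D) \<and>
     (\<forall>i\<in>conv_areas D. 0 \<le> p_peak D i \<and> (\<forall>h\<in>da_hours D. delta_DA D i h \<in> {0, 1}))"

definition economic_conditions :: "'g id_data \<Rightarrow> bool" where
  "economic_conditions D \<longleftrightarrow>
     (\<forall>m\<in>scens D. 0 < prob D m \<and> prob D m \<le> 1) \<and> (\<Sum>m\<in>scens D. prob D m) = 1 \<and>
     (\<forall>g\<in>units D. \<forall>t\<in>stages D. 0 \<le> cost_g D g t \<and> 0 \<le> cost_p D g t \<and> 0 \<le> cost_a D g t) \<and>
     (\<forall>i\<in>batt_areas D. 0 \<le> cost_b D i \<and> 0 \<le> w_soc D i) \<and>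
     (\<forall>i\<in>ren_areas D. 0 \<le> cost_ct D i) \<and>
     (\<forall>i\<in>areas D. 0 \<le> cost_rg D i \<and> 0 \<le> eps D i) \<and>
     0 \<le> cost_pk D \<and> 0 < cost_ls D \<and>
     (\<forall>i\<in>conv_areas D. \<forall>t\<in>stages D. price_Ex D i t < price_E D i t)"

definition standing_conditions :: "'g id_data \<Rightarrow> bool" where
  "standing_conditions D \<longleftrightarrow> graph_conditions D \<and> device_conditions D \<and>
     scenario_conditions D \<and> day_ahead_conditions D \<and> economic_conditions D"


section \<open>Local variables\<close>

text \<open>
  Names of the scalar coordinates of \<open>x\<^sub>i\<close>. Inside \<open>x\<^sub>i\<close>, \<open>Angle a t m\<close> is \<open>\<theta>\<^sub>a\<^sub>,\<^sub>i(t,m)\<close>: the own angle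
  for \<open>a = i\<close>, a neighbour-angle copy otherwise; \<open>Flow e t m\<close> is the copy of the flow on \<open>e\<close> held by \<open>i\<close>.
\<close>

datatype 'g coord =
    Conv nat nat | QPlus nat nat | QMinus nat nat | Peak nat
  | Charge nat nat | Discharge nat nat | Energy nat nat
  | Res nat nat | Gen 'g nat nat | Pump 'g nat nat | Reg nat nat
  | Angle nat nat nat | Flow "nat \<times> nat" nat nat | Loss "nat \<times> nat" nat nat

definition coords :: "('g::linorder) id_data \<Rightarrow> nat \<Rightarrow> 'g coord list" where
  "coords D i =
     (if i \<in> conv_areas D then
        [Conv t m. (t, m) \<leftarrow> tm_list D] @ [QPlus t m. (t, m) \<leftarrow> tm_list D] @
        [QMinus t m. (t, m) \<leftarrow> tm_list D] @ [Peak m. m \<leftarrow> scen_list D]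
      else []) @
     (if i \<in> batt_areas D then
        [Charge t m. (t, m) \<leftarrow> tm_list D] @ [Discharge t m. (t, m) \<leftarrow> tm_list D] @
        [Energy s m. s \<leftarrow> [0..<Suc (horizon D)], m \<leftarrow> scen_list D]
      else []) @
     (if i \<in> ren_areas D then [Res t m. (t, m) \<leftarrow> tm_list D] else []) @
     [Gen g t m. g \<leftarrow> unit_list D i, (t, m) \<leftarrow> tm_list D] @
     [Pump g t m. g \<leftarrow> unit_list D i, (t, m) \<leftarrow> tm_list D] @
     [Reg t m. (t, m) \<leftarrow> tm_list D] @
     [Angle i t m. (t, m) \<leftarrow> tm_list D] @
     [Flow e t m. e \<leftarrow> inc_list D i, (t, m) \<leftarrow> tm_list D] @
     [Angle j t m. j \<leftarrow> nbr_list D i, (t, m) \<leftarrow> tm_list D] @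
     [Loss e t m. e \<leftarrow> out_list D i, (t, m) \<leftarrow> tm_list D]"

definition n_loc :: "('g::linorder) id_data \<Rightarrow> nat \<Rightarrow> nat" where
  "n_loc D i = length (coords D i)"

text \<open>The value of a named coordinate in \<open>x\<^sub>i\<close>; it is zero if the coordinate is absent.\<close>

definition val :: "('g::linorder) id_data \<Rightarrow> nat \<Rightarrow> real vec \<Rightarrow> 'g coord \<Rightarrow> real" where
  "val D i x c = (case map_of (zip (coords D i) (list_of_vec x)) c of None \<Rightarrow> 0 | Some r \<Rightarrow> r)"

definition u_coords :: "('g::linorder) id_data \<Rightarrow> nat \<Rightarrow> nat \<Rightarrow> nat \<Rightarrow> 'g coord list" where
  "u_coords D i t m =
     (if i \<in> conv_areas D then [Conv t m] else []) @
     (if i \<in> batt_areas D then [Charge t m, Discharge t m] else []) @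
     (if i \<in> ren_areas D then [Res t m] else []) @
     [Reg t m] @ concat (map (\<lambda>g. [Gen g t m, Pump g t m]) (unit_list D i))"

definition u_vec :: "('g::linorder) id_data \<Rightarrow> nat \<Rightarrow> real vec \<Rightarrow> nat \<Rightarrow> nat \<Rightarrow> real vec" where
  "u_vec D i x t m = vec_of_list (map (val D i x) (u_coords D i t m))"


section \<open>Local feasible sets\<close>

definition network_constraints :: "('g::linorder) id_data \<Rightarrow> nat \<Rightarrow> ('g coord \<Rightarrow> real) \<Rightarrow> bool" where
  "network_constraints D i y \<longleftrightarrow> (\<forall>t\<in>stages D. \<forall>m\<in>scens D.
     0 \<le> y (Reg t m) \<and> y (Reg t m) \<le> P_av D i t m \<and>
     y (Conv t m) + (\<Sum>g\<in>units_at D i. y (Gen g t m) - y (Pump g t m))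
       + y (Discharge t m) - y (Charge t m) + y (Res t m) + y (Reg t m)
       - (\<Sum>e\<in>inc_lines D i. line_sgn i e * y (Flow e t m)) = P_mot D i t m \<and>
     (\<forall>e\<in>inc_lines D i.
        y (Flow e t m) = line_sgn i e * line_B D e * (y (Angle i t m) - y (Angle (other_end i e) t m)) \<and>
        \<bar>y (Flow e t m)\<bar> \<le> line_P D e) \<and>
     (\<forall>e\<in>out_lines D i. \<forall>k\<in>{1..n_cuts D}. y (Loss e t m) \<ge> cut_a D e k * y (Flow e t m) + cut_b D e k))"

definition battery_constraints :: "('g::linorder) id_data \<Rightarrow> nat \<Rightarrow> ('g coord \<Rightarrow> real) \<Rightarrow> bool" where
  "battery_constraints D i y \<longleftrightarrow> (\<forall>m\<in>scens D.
     y (Energy 0 m) = E_init D i \<and>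
     (\<forall>t\<in>stages D.
        y (Energy (t + 1) m) = y (Energy t m) + dt * (eta_c D i * y (Charge t m) - y (Discharge t m) / eta_d D i) \<and>
        0 \<le> y (Charge t m) \<and> y (Charge t m) \<le> P_bmax D i \<and>
        0 \<le> y (Discharge t m) \<and> y (Discharge t m) \<le> P_bmax D i) \<and>
     (\<forall>s\<in>{0..horizon D}. E_min D i \<le> y (Energy s m) \<and> y (Energy s m) \<le> E_max D i) \<and>
     y (Energy (horizon D) m) \<ge> E_term D i)"

definition converter_constraints :: "('g::linorder) id_data \<Rightarrow> nat \<Rightarrow> ('g coord \<Rightarrow> real) \<Rightarrow> bool" where
  "converter_constraints D i y \<longleftrightarrow> (\<forall>m\<in>scens D.
     (\<forall>t\<in>stages D.
        y (Conv t m) = y (QPlus t m) - y (QMinus t m) \<and> 0 \<le> y (QPlus t m) \<and> 0 \<le> y (QMinus t m) \<and>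
        delta_DA D i (hour_of D t) * P_cvmin D i \<le> y (Conv t m) \<and>
        y (Conv t m) \<le> delta_DA D i (hour_of D t) * P_cvmax D i) \<and>
     \<bar>y (Conv 0 m) - p_prev D i\<bar> \<le> P_ramp D i \<and>
     (\<forall>t\<in>stages D. t \<ge> 1 \<longrightarrow> \<bar>y (Conv t m) - y (Conv (t - 1) m)\<bar> \<le> P_ramp D i) \<and>
     (\<forall>t\<in>stages D. y (Peak m) \<ge> y (QPlus t m) - p_peak D i) \<and> y (Peak m) \<ge> 0 \<and>
     (\<forall>h\<in>energy_hours D. dt * (\<Sum>t\<in>hour_stages D h. y (Conv t m)) = e_DA D i h - e_past D i h))"

definition unit_constraints :: "('g::linorder) id_data \<Rightarrow> nat \<Rightarrow> ('g coord \<Rightarrow> real) \<Rightarrow> bool" where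
  "unit_constraints D i y \<longleftrightarrow> (\<forall>t\<in>stages D. \<forall>m\<in>scens D. \<forall>g\<in>units_at D i.
     0 \<le> y (Gen g t m) \<and> y (Gen g t m) \<le> P_gmax D g t m \<and>
     0 \<le> y (Pump g t m) \<and> y (Pump g t m) \<le> P_pmax D g t m)"

definition renewable_constraints :: "('g::linorder) id_data \<Rightarrow> nat \<Rightarrow> ('g coord \<Rightarrow> real) \<Rightarrow> bool" where
  "renewable_constraints D i y \<longleftrightarrow> (\<forall>t\<in>stages D. \<forall>m\<in>scens D.
     0 \<le> y (Res t m) \<and> y (Res t m) \<le> P_resmax D i t m)"

definition local_feasible :: "('g::linorder) id_data \<Rightarrow> nat \<Rightarrow> real vec set" where
  "local_feasible D i = {x \<in> carrier_vec (n_loc D i).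
     network_constraints D i (val D i x) \<and>
     (i \<in> batt_areas D \<longrightarrow> battery_constraints D i (val D i x)) \<and>
     (i \<in> conv_areas D \<longrightarrow> converter_constraints D i (val D i x)) \<and>
     unit_constraints D i (val D i x) \<and>
     (i \<in> ren_areas D \<longrightarrow> renewable_constraints D i (val D i x)) \<and>
     (\<forall>m\<in>scens D. \<forall>m'\<in>scens D. u_vec D i x 0 m = u_vec D i x 0 m')}"


section \<open>Objective\<close>

definition stage_cost ::
  "('g::linorder) id_data \<Rightarrow> nat \<Rightarrow> ('g coord \<Rightarrow> real) \<Rightarrow> nat \<Rightarrow> nat \<Rightarrow> real" where
  "stage_cost D i y t m =
     (if i \<in> conv_areas D then
        dt * (price_E D i t * y (QPlus t m) - price_Ex D i t * y (QMinus t m)) + cost_pk D * y (Peak m)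
      else 0)
     + (if i \<in> batt_areas D then dt * cost_b D i * (y (Charge t m) + y (Discharge t m)) else 0)
     + (if i \<in> ren_areas D then dt * cost_ct D i * (P_resmax D i t m - y (Res t m)) else 0)
     + dt * cost_rg D i * (P_av D i t m - y (Reg t m))
     + dt * (\<Sum>g\<in>units_at D i. cost_g D g t * y (Gen g t m) + cost_p D g t * y (Pump g t m)
               + cost_a D g t / 2 * (y (Gen g t m) - y (Pump g t m))\<^sup>2)"

definition local_cost :: "('g::linorder) id_data \<Rightarrow> nat \<Rightarrow> real vec \<Rightarrow> real" where
  "local_cost D i x = (let y = val D i x in
     (\<Sum>m\<in>scens D. prob D m * (\<Sum>t\<in>stages D.
        stage_cost D i y t m + (\<Sum>e\<in>out_lines D i. cost_ls D * y (Loss e t m) * dt)))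
     + (if i \<in> batt_areas D then
          w_soc D i / 2 * (\<Sum>m\<in>scens D. prob D m * (\<Sum>t\<in>stages D.
            (y (Energy (t + 1) m) - E_ref D i (t + 1))\<^sup>2))
        else 0)
     + eps D i / 2 * (x \<bullet> x))"


section \<open>The planning problem\<close>

text \<open>
  \<open>vsum\<close> and \<open>msum\<close> are finite sums of vectors and matrices of a given size, \<open>vstack\<close> stacks
  matrices with \<open>n\<close> columns, \<open>col_vecs\<close> stacks vectors.
\<close>

definition vsum :: "nat \<Rightarrow> 'a set \<Rightarrow> ('a \<Rightarrow> real vec) \<Rightarrow> real vec" where
  "vsum n S F = vec n (\<lambda>k. \<Sum>s\<in>S. F s $ k)"

definition msum :: "nat \<Rightarrow> 'a set \<Rightarrow> ('a \<Rightarrow> real mat) \<Rightarrow> real mat" where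
  "msum n S F = mat n n (\<lambda>kl. \<Sum>s\<in>S. F s $$ kl)"

definition vstack :: "nat \<Rightarrow> real mat list \<Rightarrow> real mat" where
  "vstack n As = mat_of_rows n (concat (map rows As))"

definition col_vecs :: "real vec list \<Rightarrow> real vec" where
  "col_vecs vs = vec_of_list (concat (map list_of_vec vs))"

text \<open>The selection row of a named coordinate; it is zero if the coordinate is absent.\<close>

definition R_row :: "('g::linorder) id_data \<Rightarrow> nat \<Rightarrow> 'g coord \<Rightarrow> real vec" where
  "R_row D i c = vec (n_loc D i) (\<lambda>k. if coords D i ! k = c then 1 else 0)"

definition S_mat :: "('g::linorder) id_data \<Rightarrow> nat \<Rightarrow> nat \<Rightarrow> real mat" where
  "S_mat D i a = mat_of_rows (n_loc D i) [R_row D i (Angle a t m). (t, m) \<leftarrow> tm_list D]"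

text \<open>The decision variables are \<open>(x, z)\<close> with \<open>x i \<in> \<real>\<^bsup>n\<^sub>i\<^esup>\<close> and \<open>z a \<in> \<real>\<^bsup>HM\<^esup>\<close>.\<close>

definition ID_space :: "('g::linorder) id_data \<Rightarrow> ((nat \<Rightarrow> real vec) \<times> (nat \<Rightarrow> real vec)) set" where
  "ID_space D = (PiE (areas D) (\<lambda>i. carrier_vec (n_loc D i))) \<times> (PiE (areas D) (\<lambda>a. carrier_vec (HM D)))"

definition ID_feasible :: "('g::linorder) id_data \<Rightarrow> ((nat \<Rightarrow> real vec) \<times> (nat \<Rightarrow> real vec)) set" where
  "ID_feasible D = {(x, z) \<in> ID_space D.
     (\<forall>i\<in>areas D. x i \<in> local_feasible D i) \<and>
     (\<forall>i\<in>areas D. \<forall>a\<in>insert i (nbrs D i). S_mat D i a *\<^sub>v x i = z a) \<and>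
     z (ref_area D) = 0\<^sub>v (HM D)}"

definition ID_objective :: "('g::linorder) id_data \<Rightarrow> (nat \<Rightarrow> real vec) \<times> (nat \<Rightarrow> real vec) \<Rightarrow> real" where
  "ID_objective D = (\<lambda>(x, z). \<Sum>i\<in>areas D. local_cost D i (x i))"

definition n_tot :: "('g::linorder) id_data \<Rightarrow> nat" where
  "n_tot D = (\<Sum>i\<in>areas D. n_loc D i) + n_areas D * HM D"

definition stack :: "'g id_data \<Rightarrow> (nat \<Rightarrow> real vec) \<times> (nat \<Rightarrow> real vec) \<Rightarrow> real vec" where
  "stack D = (\<lambda>(x, z). col_vecs (map x (area_list D) @ map z (area_list D)))"


section \<open>Explicit matrices\<close>

text \<open>Local constraints are listed as pairs (coefficient row, right-hand side).\<close>

definition balance_row :: "('g::linorder) id_data \<Rightarrow> nat \<Rightarrow> nat \<Rightarrow> nat \<Rightarrow> real vec" where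
  "balance_row D i t m =
     R_row D i (Conv t m) + R_row D i (Discharge t m) - R_row D i (Charge t m) + R_row D i (Res t m) + R_row D i (Reg t m)
     + vsum (n_loc D i) (units_at D i) (\<lambda>g. R_row D i (Gen g t m) - R_row D i (Pump g t m))
     - vsum (n_loc D i) (inc_lines D i) (\<lambda>e. line_sgn i e \<cdot>\<^sub>v R_row D i (Flow e t m))"

definition eq_rows :: "('g::linorder) id_data \<Rightarrow> nat \<Rightarrow> (real vec \<times> real) list" where
  "eq_rows D i =
     [(balance_row D i t m, P_mot D i t m). (t, m) \<leftarrow> tm_list D] @
     [(R_row D i (Flow e t m)
         - (line_sgn i e * line_B D e) \<cdot>\<^sub>v (R_row D i (Angle i t m) - R_row D i (Angle (other_end i e) t m)), 0).
        e \<leftarrow> inc_list D i, (t, m) \<leftarrow> tm_list D] @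
     (if i \<in> batt_areas D then
        [(R_row D i (Energy (t + 1) m) - R_row D i (Energy t m) - (dt * eta_c D i) \<cdot>\<^sub>v R_row D i (Charge t m)
            + (dt * inverse (eta_d D i)) \<cdot>\<^sub>v R_row D i (Discharge t m), 0). (t, m) \<leftarrow> tm_list D] @
        [(R_row D i (Energy 0 m), E_init D i). m \<leftarrow> scen_list D]
      else []) @
     (if i \<in> conv_areas D then
        [(R_row D i (Conv t m) - R_row D i (QPlus t m) + R_row D i (QMinus t m), 0). (t, m) \<leftarrow> tm_list D] @
        [(dt \<cdot>\<^sub>v vsum (n_loc D i) (hour_stages D h) (\<lambda>t. R_row D i (Conv t m)), e_DA D i h - e_past D i h).
           h \<leftarrow> sorted_list_of_set (energy_hours D), m \<leftarrow> scen_list D]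
      else []) @
     [(R_row D i c - R_row D i c', 0).
        m \<leftarrow> [2..<Suc (n_scen D)], (c, c') \<leftarrow> zip (u_coords D i 0 m) (u_coords D i 0 1)]"

text \<open>Coordinate bounds as (coordinate, lower endpoint, upper endpoint or \<open>None\<close>).\<close>

definition bounds :: "('g::linorder) id_data \<Rightarrow> nat \<Rightarrow> ('g coord \<times> real \<times> real option) list" where
  "bounds D i =
     [(Reg t m, 0, Some (P_av D i t m)). (t, m) \<leftarrow> tm_list D] @
     [(Flow e t m, - line_P D e, Some (line_P D e)). e \<leftarrow> inc_list D i, (t, m) \<leftarrow> tm_list D] @
     (if i \<in> batt_areas D then
        [(Energy s m, E_min D i, Some (E_max D i)). s \<leftarrow> [0..<Suc (horizon D)], m \<leftarrow> scen_list D] @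
        [(Charge t m, 0, Some (P_bmax D i)). (t, m) \<leftarrow> tm_list D] @
        [(Discharge t m, 0, Some (P_bmax D i)). (t, m) \<leftarrow> tm_list D]
      else []) @
     (if i \<in> conv_areas D then
        [(QPlus t m, 0, None). (t, m) \<leftarrow> tm_list D] @
        [(QMinus t m, 0, None). (t, m) \<leftarrow> tm_list D] @
        [(Conv t m, delta_DA D i (hour_of D t) * P_cvmin D i,
            Some (delta_DA D i (hour_of D t) * P_cvmax D i)). (t, m) \<leftarrow> tm_list D] @
        [(Peak m, 0, None). m \<leftarrow> scen_list D]
      else []) @
     [(Gen g t m, 0, Some (P_gmax D g t m)). g \<leftarrow> unit_list D i, (t, m) \<leftarrow> tm_list D] @
     [(Pump g t m, 0, Some (P_pmax D g t m)). g \<leftarrow> unit_list D i, (t, m) \<leftarrow> tm_list D] @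
     (if i \<in> ren_areas D then [(Res t m, 0, Some (P_resmax D i t m)). (t, m) \<leftarrow> tm_list D] else [])"

definition bound_rows ::
  "('g::linorder) id_data \<Rightarrow> nat \<Rightarrow> 'g coord \<times> real \<times> real option \<Rightarrow> (real vec \<times> real) list" where
  "bound_rows D i = (\<lambda>(c, lo, hi). (- R_row D i c, - lo) #
     (case hi of None \<Rightarrow> [] | Some b \<Rightarrow> [(R_row D i c, b)]))"

definition in_rows :: "('g::linorder) id_data \<Rightarrow> nat \<Rightarrow> (real vec \<times> real) list" where
  "in_rows D i =
     concat (map (bound_rows D i) (bounds D i)) @
     (if i \<in> batt_areas D then
        [(- R_row D i (Energy (horizon D) m), - E_term D i). m \<leftarrow> scen_list D]
      else []) @
     (if i \<in> conv_areas D then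
        [(\<zeta> \<cdot>\<^sub>v R_row D i (Conv 0 m), P_ramp D i + \<zeta> * p_prev D i). m \<leftarrow> scen_list D, \<zeta> \<leftarrow> [- 1, 1]] @
        [(\<zeta> \<cdot>\<^sub>v (R_row D i (Conv t m) - R_row D i (Conv (t - 1) m)), P_ramp D i).
           t \<leftarrow> [1..<horizon D], m \<leftarrow> scen_list D, \<zeta> \<leftarrow> [- 1, 1]] @
        [(R_row D i (QPlus t m) - R_row D i (Peak m), p_peak D i). (t, m) \<leftarrow> tm_list D]
      else []) @
     [(cut_a D e k \<cdot>\<^sub>v R_row D i (Flow e t m) - R_row D i (Loss e t m), - cut_b D e k).
        e \<leftarrow> out_list D i, (t, m) \<leftarrow> tm_list D, k \<leftarrow> [1..<Suc (n_cuts D)]]"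

definition A_eq_loc :: "('g::linorder) id_data \<Rightarrow> nat \<Rightarrow> real mat" where
  "A_eq_loc D i = mat_of_rows (n_loc D i) (map fst (eq_rows D i))"

definition b_eq_loc :: "('g::linorder) id_data \<Rightarrow> nat \<Rightarrow> real vec" where
  "b_eq_loc D i = vec_of_list (map snd (eq_rows D i))"

definition A_in_loc :: "('g::linorder) id_data \<Rightarrow> nat \<Rightarrow> real mat" where
  "A_in_loc D i = mat_of_rows (n_loc D i) (map fst (in_rows D i))"

definition b_in_loc :: "('g::linorder) id_data \<Rightarrow> nat \<Rightarrow> real vec" where
  "b_in_loc D i = vec_of_list (map snd (in_rows D i))"

definition D_eq :: "('g::linorder) id_data \<Rightarrow> real mat" where
  "D_eq D = diag_block_mat (map (A_eq_loc D) (area_list D))"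

definition D_in :: "('g::linorder) id_data \<Rightarrow> real mat" where
  "D_in D = diag_block_mat (map (A_in_loc D) (area_list D))"

definition S_hat :: "('g::linorder) id_data \<Rightarrow> real mat" where
  "S_hat D = diag_block_mat
     (map (\<lambda>i. vstack (n_loc D i) (map (S_mat D i) (i # nbr_list D i))) (area_list D))"

text \<open>The Kronecker product of the row \<open>e\<^sub>a\<^sup>T\<close> with the identity of size \<open>HM\<close>, written entrywise.\<close>

definition Z_mat :: "'g id_data \<Rightarrow> nat \<Rightarrow> real mat" where
  "Z_mat D a = mat (HM D) (n_areas D * HM D)
     (\<lambda>(k, l). unit_vec (n_areas D) (a - 1) $ (l div HM D) * 1\<^sub>m (HM D) $$ (k, l mod HM D))"

definition Z_hat :: "'g id_data \<Rightarrow> real mat" where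
  "Z_hat D = vstack (n_areas D * HM D)
     (concat (map (\<lambda>i. map (Z_mat D) (i # nbr_list D i)) (area_list D)))"

definition A_eq :: "('g::linorder) id_data \<Rightarrow> real mat" where
  "A_eq D =
     four_block_mat
       (D_eq D)  (0\<^sub>m (dim_row (D_eq D)) (n_areas D * HM D))
       (S_hat D) (- Z_hat D)
     @\<^sub>r
     four_block_mat
       (0\<^sub>m (HM D) (\<Sum>i\<in>areas D. n_loc D i)) (Z_mat D (ref_area D))
       (0\<^sub>m 0 (\<Sum>i\<in>areas D. n_loc D i))      (0\<^sub>m 0 (n_areas D * HM D))"

definition b_eq :: "('g::linorder) id_data \<Rightarrow> real vec" where
  "b_eq D = col_vecs (map (b_eq_loc D) (area_list D) @
     [0\<^sub>v (HM D * (\<Sum>i\<in>areas D. 1 + card (nbrs D i))), 0\<^sub>v (HM D)])"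

definition A_in :: "('g::linorder) id_data \<Rightarrow> real mat" where
  "A_in D =
     four_block_mat
       (D_in D)                             (0\<^sub>m (dim_row (D_in D)) (n_areas D * HM D))
       (0\<^sub>m 0 (\<Sum>i\<in>areas D. n_loc D i)) (0\<^sub>m 0 (n_areas D * HM D))"

definition b_in :: "('g::linorder) id_data \<Rightarrow> real vec" where
  "b_in D = col_vecs (map (b_in_loc D) (area_list D))"

text \<open>For a row \<open>r\<close> this is the matrix \<open>r\<^sup>T r\<close>.\<close>

definition row_sq :: "real vec \<Rightarrow> real mat" where
  "row_sq r = (mat_of_row r)\<^sup>T * mat_of_row r"

definition Q_loc :: "('g::linorder) id_data \<Rightarrow> nat \<Rightarrow> real mat" where
  "Q_loc D i = (let n = n_loc D i in
     eps D i \<cdot>\<^sub>m 1\<^sub>m n + msum n (scens D) (\<lambda>m. prob D m \<cdot>\<^sub>m msum n (stages D) (\<lambda>t.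
       w_soc D i \<cdot>\<^sub>m row_sq (R_row D i (Energy (t + 1) m))
       + dt \<cdot>\<^sub>m msum n (units_at D i) (\<lambda>g.
           cost_a D g t \<cdot>\<^sub>m row_sq (R_row D i (Gen g t m) - R_row D i (Pump g t m))))))"

definition q_loc :: "('g::linorder) id_data \<Rightarrow> nat \<Rightarrow> real vec" where
  "q_loc D i = (let n = n_loc D i in
     vsum n (scens D) (\<lambda>m. prob D m \<cdot>\<^sub>v vsum n (stages D) (\<lambda>t.
       dt \<cdot>\<^sub>v (price_E D i t \<cdot>\<^sub>v R_row D i (QPlus t m) - price_Ex D i t \<cdot>\<^sub>v R_row D i (QMinus t m)
         + cost_b D i \<cdot>\<^sub>v (R_row D i (Charge t m) + R_row D i (Discharge t m))
         - cost_ct D i \<cdot>\<^sub>v R_row D i (Res t m) - cost_rg D i \<cdot>\<^sub>v R_row D i (Reg t m)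
         + vsum n (units_at D i) (\<lambda>g.
             cost_g D g t \<cdot>\<^sub>v R_row D i (Gen g t m) + cost_p D g t \<cdot>\<^sub>v R_row D i (Pump g t m))
         + cost_ls D \<cdot>\<^sub>v vsum n (out_lines D i) (\<lambda>e. R_row D i (Loss e t m)))
       - (w_soc D i * E_ref D i (t + 1)) \<cdot>\<^sub>v R_row D i (Energy (t + 1) m)))
     + (real (horizon D) * cost_pk D) \<cdot>\<^sub>v vsum n (scens D) (\<lambda>m. prob D m \<cdot>\<^sub>v R_row D i (Peak m)))"

definition Q_mat :: "('g::linorder) id_data \<Rightarrow> real mat" where
  "Q_mat D = diag_block_mat (map (Q_loc D) (area_list D) @ [0\<^sub>m (n_areas D * HM D) (n_areas D * HM D)])"

definition q_vec :: "('g::linorder) id_data \<Rightarrow> real vec" where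
  "q_vec D = col_vecs (map (q_loc D) (area_list D) @ [0\<^sub>v (n_areas D * HM D)])"


section \<open>Convex quadratic programs\<close>

definition sym_psd :: "nat \<Rightarrow> real mat \<Rightarrow> bool" where
  "sym_psd n A \<longleftrightarrow> A \<in> carrier_mat n n \<and> A\<^sup>T = A \<and> (\<forall>v\<in>carrier_vec n. 0 \<le> v \<bullet> (A *\<^sub>v v))"

definition sym_pd :: "nat \<Rightarrow> real mat \<Rightarrow> bool" where
  "sym_pd n A \<longleftrightarrow> A \<in> carrier_mat n n \<and> A\<^sup>T = A \<and>
     (\<forall>v\<in>carrier_vec n. v \<noteq> 0\<^sub>v n \<longrightarrow> 0 < v \<bullet> (A *\<^sub>v v))"

definition convex_qp ::
  "nat \<Rightarrow> real mat \<Rightarrow> real vec \<Rightarrow> real mat \<Rightarrow> real vec \<Rightarrow> real mat \<Rightarrow> real vec \<Rightarrow> bool" where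
  "convex_qp n Q q Ae be Ai bi \<longleftrightarrow> sym_psd n Q \<and> q \<in> carrier_vec n \<and>
     Ae \<in> carrier_mat (dim_vec be) n \<and> Ai \<in> carrier_mat (dim_vec bi) n"

definition qp_objective :: "real mat \<Rightarrow> real vec \<Rightarrow> real vec \<Rightarrow> real" where
  "qp_objective Q q v = 1 / 2 * (v \<bullet> (Q *\<^sub>v v)) + q \<bullet> v"

definition qp_feasible ::
  "nat \<Rightarrow> real mat \<Rightarrow> real vec \<Rightarrow> real mat \<Rightarrow> real vec \<Rightarrow> real vec set" where
  "qp_feasible n Ae be Ai bi = {v \<in> carrier_vec n. Ae *\<^sub>v v = be \<and> Ai *\<^sub>v v \<le> bi}"

end

theory Submission
  imports Defs
begin

text \<open>
  Every local variable is a list of named scalar coordinates without repetition. Hence the scalar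
  product of \<open>x\<^sub>i\<close> with the selection row of a coordinate is the value of that coordinate
  (\<open>R_row_scalar_prod\<close>), including the value zero of a coordinate that belongs to an absent asset.
  Everything else is bookkeeping on top of this fact.

  Constraints. Each local constraint is affine in the named coordinates, so it is literally one of the
  listed pairs (coefficient row, right-hand side); an absolute value or a two-sided bound gives two
  rows, and nonanticipativity between all pairs of scenarios is the same as equality with scenario 1
  (\<open>local_feasible_iff\<close>). The global matrices are block diagonal in the areas, apart from the
  consensus rows. A block-diagonal matrix acts on a stacked vector block by block, and stacked vectors are
  compared block by block, so the stacked system splits into the local systems. In the consensus
  rows, \<open>Z\<^sub>a\<close> extracts \<open>z\<^sub>a\<close> from the stack of all \<open>z\<close> (\<open>Z_mat_mult_vec\<close>), and they
  become the equations \<open>S\<^sub>i\<^sup>(\<^sup>a\<^sup>) x\<^sub>i = z\<^sub>a\<close>. Together this is \<open>ID_feasible_iff\<close>.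

  Objective. The cost, the quadratic form of \<open>Q\<^sub>i\<close> and the linear form \<open>q\<^sub>i\<close> are all weighted sums over
  scenarios and stages, plus the term with \<open>\<epsilon>\<^sub>i\<close>. They are compared one summand at a time: expanding the
  square \<open>(E - E\<^sup>r\<^sup>e\<^sup>f)\<^sup>2\<close> and the curtailment terms leaves a remainder that does not depend on
  \<open>x\<^sub>i\<close> (\<open>local_cost_eq\<close>).

  Convexity. The same expansion shows that the quadratic form of \<open>Q\<^sub>i\<close> is \<open>\<epsilon>\<^sub>i \<parallel>x\<^sub>i\<parallel>\<^sup>2\<close> plus nonnegative
  multiples of squares (\<open>quad_form_Q_loc_ge\<close>). Thus \<open>Q\<^sub>i\<close> is positive semidefinite, and positive definite
  if \<open>\<epsilon>\<^sub>i > 0\<close>; the form of \<open>Q\<close> on a stacked vector is the sum of the local forms.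
\<close>

section \<open>Stacked vectors and block matrices\<close>

lemma col_vecs_Nil [simp]: "col_vecs [] = vNil"
  by (simp add: col_vecs_def)

lemma col_vecs_append: "col_vecs (us @ vs) = col_vecs us @\<^sub>v col_vecs vs"
  unfolding col_vecs_def
  by (rule eq_vecI) (auto simp: vec_of_list_index nth_append)

lemma col_vecs_Cons [simp]: "col_vecs (v # vs) = v @\<^sub>v col_vecs vs"
  using col_vecs_append[of "[v]" vs] by (simp add: col_vecs_def vec_list)

lemma append_vNil [simp]: "v @\<^sub>v vNil = v"
  by (rule eq_vecI) auto

lemma zero_mat_mult_vec: "v \<in> carrier_vec n \<Longrightarrow> 0\<^sub>m k n *\<^sub>v v = 0\<^sub>v k" for v :: "real vec"
  by (rule eq_vecI) (auto simp: scalar_prod_def)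

lemma vec_dim_0: "dim_vec v = 0 \<Longrightarrow> v = vNil"
  by (rule eq_vecI) auto

lemma dim_col_vecs: "dim_vec (col_vecs vs) = (\<Sum>v\<leftarrow>vs. dim_vec v)"
  by (induction vs) auto

lemma col_vecs_concat: "col_vecs (concat vss) = col_vecs (map col_vecs vss)"
  by (induction vss) (auto simp: col_vecs_append)

text \<open>
  Equal dimensions are essential: the order on vectors of different dimensions is always false, while
  the appended vectors could still be comparable.
\<close>

lemma append_vec_le_iff:
  fixes u v :: "real vec"
  assumes "dim_vec u = dim_vec v" and "dim_vec w = dim_vec z"
  shows "u @\<^sub>v w \<le> v @\<^sub>v z \<longleftrightarrow> u \<le> v \<and> w \<le> z"
proof -
  have "u \<le> v \<and> w \<le> z" if "u @\<^sub>v w \<le> v @\<^sub>v z"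
  proof -
    have le: "(u @\<^sub>v w) $ k \<le> (v @\<^sub>v z) $ k" if "k < dim_vec u + dim_vec w" for k
      using \<open>u @\<^sub>v w \<le> v @\<^sub>v z\<close> that by (auto simp: less_eq_vec_def)
    have "u $ k \<le> v $ k" if "k < dim_vec u" for k
      using le[of k] that assms by simp
    moreover have "w $ k \<le> z $ k" if "k < dim_vec w" for k
      using le[of "dim_vec u + k"] that assms by simp
    ultimately show ?thesis using assms by (auto simp: less_eq_vec_def)
  qed
  moreover have "u @\<^sub>v w \<le> v @\<^sub>v z" if "u \<le> v \<and> w \<le> z"
    using that assms by (auto simp: less_eq_vec_def)
  ultimately show ?thesis by blast
qed

lemma col_vecs_eq_iff:
  assumes "\<And>i. i \<in> set is \<Longrightarrow> dim_vec (u i) = dim_vec (v i)"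
  shows "col_vecs (map u is) = col_vecs (map v is) \<longleftrightarrow> (\<forall>i\<in>set is. u i = v i)"
  using assms
proof (induction "is")
  case (Cons i "is")
  have "u i @\<^sub>v col_vecs (map u is) = v i @\<^sub>v col_vecs (map v is) \<longleftrightarrow>
      u i = v i \<and> col_vecs (map u is) = col_vecs (map v is)"
    by (rule append_vec_eq) (rule carrier_vecI, rule Cons.prems, simp_all)
  moreover have "col_vecs (map u is) = col_vecs (map v is) \<longleftrightarrow> (\<forall>i\<in>set is. u i = v i)"
    by (rule Cons.IH) (simp add: Cons.prems)
  ultimately show ?case by simp
qed simp

lemma col_vecs_le_iff:
  fixes u v :: "'i \<Rightarrow> real vec"
  assumes "\<And>i. i \<in> set is \<Longrightarrow> dim_vec (u i) = dim_vec (v i)"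
  shows "col_vecs (map u is) \<le> col_vecs (map v is) \<longleftrightarrow> (\<forall>i\<in>set is. u i \<le> v i)"
  using assms
proof (induction "is")
  case (Cons i "is")
  have "dim_vec (col_vecs (map u is)) = dim_vec (col_vecs (map v is))"
    unfolding dim_col_vecs by (simp add: comp_def Cons.prems cong: map_cong)
  then have "u i @\<^sub>v col_vecs (map u is) \<le> v i @\<^sub>v col_vecs (map v is) \<longleftrightarrow>
      u i \<le> v i \<and> col_vecs (map u is) \<le> col_vecs (map v is)"
    by (intro append_vec_le_iff) (simp_all add: Cons.prems)
  moreover have "col_vecs (map u is) \<le> col_vecs (map v is) \<longleftrightarrow> (\<forall>i\<in>set is. u i \<le> v i)"
    by (rule Cons.IH) (simp add: Cons.prems)
  ultimately show ?case by simp
qed simp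

lemma scalar_prod_col_vecs:
  assumes "\<And>i. i \<in> set is \<Longrightarrow> dim_vec (u i) = dim_vec (v i)"
  shows "col_vecs (map u is) \<bullet> col_vecs (map v is) = (\<Sum>i\<leftarrow>is. u i \<bullet> v i)"
  using assms
proof (induction "is")
  case Nil
  then show ?case by (simp add: scalar_prod_def)
next
  case (Cons i "is")
  have "dim_vec (col_vecs (map u is)) = dim_vec (col_vecs (map v is))"
    unfolding dim_col_vecs by (simp add: comp_def Cons.prems cong: map_cong)
  then have "(u i @\<^sub>v col_vecs (map u is)) \<bullet> (v i @\<^sub>v col_vecs (map v is))
      = u i \<bullet> v i + col_vecs (map u is) \<bullet> col_vecs (map v is)"
    by (intro scalar_prod_append[where ?n1.0 = "dim_vec (v i)" and ?n2.0 = "dim_vec (col_vecs (map v is))"])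
      (auto intro!: carrier_vecI Cons.prems)
  moreover have "col_vecs (map u is) \<bullet> col_vecs (map v is) = (\<Sum>i\<leftarrow>is. u i \<bullet> v i)"
    by (rule Cons.IH) (simp add: Cons.prems)
  ultimately show ?case by simp
qed

text \<open>
  With blocks of equal size the entries are addressed by quotient and remainder; this is what turns the
  Kronecker-product description of \<open>Z\<^sub>a\<close> into the selection of a block.
\<close>

lemma col_vecs_index:
  assumes "\<And>v. v \<in> set vs \<Longrightarrow> dim_vec v = n" and "p < length vs" and "k < n"
  shows "col_vecs vs $ (p * n + k) = vs ! p $ k"
  using assms
proof (induction vs arbitrary: p)
  case (Cons v vs)
  have dim: "dim_vec (col_vecs vs) = length vs * n"
    using Cons.prems(1) by (simp add: dim_col_vecs sum_list_triv cong: map_cong)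
  show ?case
  proof (cases p)
    case 0
    then show ?thesis using Cons.prems dim by simp
  next
    case (Suc p')
    then have p': "p' < length vs" using Cons.prems by simp
    then have "Suc p' * n \<le> length vs * n" by (intro mult_right_mono) auto
    then have "p' * n + k < length vs * n" using Cons.prems(3) by simp
    then show ?thesis
      using Cons.IH[OF _ p'] Cons.prems Suc dim by (simp add: add.assoc)
  qed
qed simp

text \<open>
  The blocks are split off from the front one at a time. Distinctness of the index list makes it harmless
  to redefine the family at the head index.
\<close>

lemma col_vecs_surj:
  assumes "distinct is" and "v \<in> carrier_vec (\<Sum>i\<leftarrow>is. n i)"
  obtains x where "x \<in> (\<Pi>\<^sub>E i\<in>set is. carrier_vec (n i))" and "col_vecs (map x is) = v"
proof -
  have "\<exists>x \<in> (\<Pi>\<^sub>E i\<in>set is. carrier_vec (n i)). col_vecs (map x is) = v"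
    using assms
  proof (induction "is" arbitrary: v)
    case Nil
    then show ?case by (auto intro!: eq_vecI)
  next
    case (Cons i "is")
    let ?m = "\<Sum>i\<leftarrow>is. n i"
    obtain x where x: "x \<in> (\<Pi>\<^sub>E i\<in>set is. carrier_vec (n i))"
      and eq: "col_vecs (map x is) = vec_last v ?m"
      using Cons.IH[of "vec_last v ?m"] Cons.prems by auto
    have "map (x(i := vec_first v (n i))) is = map x is"
      using Cons.prems by auto
    then have "col_vecs (map (x(i := vec_first v (n i))) (i # is)) = vec_first v (n i) @\<^sub>v vec_last v ?m"
      unfolding list.map(2) col_vecs_Cons using eq by (simp only: fun_upd_same)
    then have "col_vecs (map (x(i := vec_first v (n i))) (i # is)) = v"
      using Cons.prems(2) by (simp only: list.map(2) sum_list.Cons vec_first_last_append)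
    moreover have "x(i := vec_first v (n i)) \<in> (\<Pi>\<^sub>E i\<in>set (i # is). carrier_vec (n i))"
      using x by (auto simp: PiE_iff extensional_def)
    ultimately show ?case by blast
  qed
  then show ?thesis using that by blast
qed

text \<open>
  The matrices and vectors form families over one common index list, so that a statement about the
  stacked system can be read off index by index.
\<close>

lemma mult_diag_block_mat_vec:
  fixes A :: "'i \<Rightarrow> real mat"
  assumes "\<And>i. i \<in> set is \<Longrightarrow> dim_col (A i) = dim_vec (x i)"
  shows "diag_block_mat (map A is) *\<^sub>v col_vecs (map x is) = col_vecs (map (\<lambda>i. A i *\<^sub>v x i) is)"
  using assms
proof (induction "is")
  case Nil
  then show ?case by (auto intro!: eq_vecI)
next
  case (Cons i "is")
  let ?B = "diag_block_mat (map A is)" and ?w = "col_vecs (map x is)"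
  have dim: "dim_col ?B = dim_vec ?w"
    using Cons.prems by (simp add: dim_diag_block_mat dim_col_vecs comp_def cong: map_cong)
  have "four_block_mat (A i) (0\<^sub>m (dim_row (A i)) (dim_col ?B)) (0\<^sub>m (dim_row ?B) (dim_col (A i))) ?B
          *\<^sub>v (x i @\<^sub>v ?w)
      = (A i *\<^sub>v x i + 0\<^sub>m (dim_row (A i)) (dim_col ?B) *\<^sub>v ?w)
          @\<^sub>v (0\<^sub>m (dim_row ?B) (dim_col (A i)) *\<^sub>v x i + ?B *\<^sub>v ?w)"
    using Cons.prems dim by (intro four_block_mat_mult_vec) (auto intro: carrier_vecI)
  also have "0\<^sub>m (dim_row (A i)) (dim_col ?B) *\<^sub>v ?w = 0\<^sub>v (dim_row (A i))"
    using dim by (intro zero_mat_mult_vec carrier_vecI) simp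
  also have "0\<^sub>m (dim_row ?B) (dim_col (A i)) *\<^sub>v x i = 0\<^sub>v (dim_row ?B)"
    using Cons.prems by (intro zero_mat_mult_vec carrier_vecI) simp
  also have "A i *\<^sub>v x i + 0\<^sub>v (dim_row (A i)) = A i *\<^sub>v x i"
    by (intro eq_vecI) auto
  also have "0\<^sub>v (dim_row ?B) + ?B *\<^sub>v ?w = ?B *\<^sub>v ?w"
    by (intro eq_vecI) auto
  finally show ?case
    using Cons by (simp add: Let_def)
qed

text \<open>
  The lower blocks have no rows: this is how a single row of two blocks is encoded.
\<close>

lemma block_row_mult_vec:
  fixes A B :: "real mat"
  assumes "A \<in> carrier_mat k n" and "B \<in> carrier_mat k l"
    and "X \<in> carrier_vec n" and "Z \<in> carrier_vec l"
  shows "four_block_mat A B (0\<^sub>m 0 n) (0\<^sub>m 0 l) *\<^sub>v (X @\<^sub>v Z) = A *\<^sub>v X + B *\<^sub>v Z"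
proof -
  have "four_block_mat A B (0\<^sub>m 0 n) (0\<^sub>m 0 l) *\<^sub>v (X @\<^sub>v Z)
      = (A *\<^sub>v X + B *\<^sub>v Z) @\<^sub>v (0\<^sub>m 0 n *\<^sub>v X + 0\<^sub>m 0 l *\<^sub>v Z)"
    using assms by (intro four_block_mat_mult_vec) auto
  also have "0\<^sub>m 0 n *\<^sub>v X + 0\<^sub>m 0 l *\<^sub>v Z = vNil"
    by (rule vec_dim_0) simp
  finally show ?thesis by simp
qed

lemma transpose_diag_block_mat:
  fixes As :: "'a::zero mat list"
  assumes "\<And>A. A \<in> set As \<Longrightarrow> A\<^sup>T = A"
  shows "(diag_block_mat As)\<^sup>T = diag_block_mat As"
  using assms
proof (induction As)
  case Nil
  then show ?case by (auto intro!: eq_matI)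
next
  case (Cons A As)
  let ?B = "diag_block_mat As"
  have IH: "?B\<^sup>T = ?B" and A: "A\<^sup>T = A" using Cons by auto
  then have sq: "dim_col A = dim_row A" "dim_col ?B = dim_row ?B"
    by (metis index_transpose_mat(3))+
  have "(four_block_mat A (0\<^sub>m (dim_row A) (dim_col ?B)) (0\<^sub>m (dim_row ?B) (dim_col A)) ?B)\<^sup>T
      = four_block_mat (A\<^sup>T) ((0\<^sub>m (dim_row ?B) (dim_col A))\<^sup>T) ((0\<^sub>m (dim_row A) (dim_col ?B))\<^sup>T) (?B\<^sup>T)"
    by (intro transpose_four_block_mat) auto
  also have "\<dots> = four_block_mat A (0\<^sub>m (dim_row A) (dim_col ?B)) (0\<^sub>m (dim_row ?B) (dim_col A)) ?B"
    unfolding IH A using sq by simp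
  finally show ?case by (simp add: Let_def)
qed

lemma sum_list_map_concat: "(\<Sum>x\<leftarrow>concat xss. f x) = (\<Sum>xs\<leftarrow>xss. \<Sum>x\<leftarrow>xs. f x)"
  by (induction xss) auto

lemma vstack_dim [simp]:
  "dim_row (vstack n As) = (\<Sum>A\<leftarrow>As. dim_row A)" "dim_col (vstack n As) = n"
  unfolding vstack_def by (simp_all add: length_concat comp_def)

lemma vstack_mult_vec:
  assumes "\<And>A. A \<in> set As \<Longrightarrow> dim_col A = n"
  shows "vstack n As *\<^sub>v x = col_vecs (map (\<lambda>A. A *\<^sub>v x) As)"
  using assms
proof (induction As)
  case Nil
  then show ?case by (auto intro!: eq_vecI simp: vstack_def)
next
  case (Cons A As)
  show ?case
  proof (rule eq_vecI)
    show "dim_vec (vstack n (A # As) *\<^sub>v x) = dim_vec (col_vecs (map (\<lambda>A. A *\<^sub>v x) (A # As)))"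
      by (simp add: dim_col_vecs comp_def)
    fix k assume "k < dim_vec (col_vecs (map (\<lambda>A. A *\<^sub>v x) (A # As)))"
    then have k: "k < dim_row A + (\<Sum>A\<leftarrow>As. dim_row A)"
      by (simp add: dim_col_vecs comp_def)
    let ?rs = "concat (map rows As)"
    have len: "length ?rs = (\<Sum>A\<leftarrow>As. dim_row A)"
      by (simp add: length_concat comp_def)
    have carr: "set (rows A @ ?rs) \<subseteq> carrier_vec n"
      using Cons.prems by (auto simp: rows_def intro!: carrier_vecI)
    have row: "row (vstack n (A # As)) k = (rows A @ ?rs) ! k"
      using k len carr nth_mem[of k "rows A @ ?rs"]
      unfolding vstack_def by (subst mat_of_rows_row) auto
    have IH: "col_vecs (map (\<lambda>A. A *\<^sub>v x) As) = vstack n As *\<^sub>v x"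
      using Cons by auto
    show "(vstack n (A # As) *\<^sub>v x) $ k = col_vecs (map (\<lambda>A. A *\<^sub>v x) (A # As)) $ k"
    proof (cases "k < dim_row A")
      case True
      then show ?thesis using k row by (simp add: nth_append dim_col_vecs comp_def)
    next
      case False
      have "row (vstack n As) (k - dim_row A) = ?rs ! (k - dim_row A)"
        using k False len carr nth_mem[of "k - dim_row A" ?rs]
        unfolding vstack_def by (subst mat_of_rows_row) auto
      then show ?thesis using k False row IH by (simp add: nth_append)
    qed
  qed
qed

text \<open>
  A list of pairs (coefficient row, right-hand side) is turned into a matrix and a vector; the next
  two lemmas turn the matrix relation back into one scalar relation per pair.
\<close>

lemma mat_of_rows_eq_iff:
  assumes "\<And>r b. (r, b) \<in> set rs \<Longrightarrow> r \<in> carrier_vec n"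
  shows "mat_of_rows n (map fst rs) *\<^sub>v x = vec_of_list (map snd rs) \<longleftrightarrow>
    (\<forall>(r, b)\<in>set rs. r \<bullet> x = b)"
proof -
  have "row (mat_of_rows n (map fst rs)) k = fst (rs ! k)" if "k < length rs" for k
    using that assms[of "fst (rs ! k)" "snd (rs ! k)"] by (subst mat_of_rows_row) auto
  then have "mat_of_rows n (map fst rs) *\<^sub>v x = vec_of_list (map snd rs) \<longleftrightarrow>
      (\<forall>k<length rs. fst (rs ! k) \<bullet> x = snd (rs ! k))"
    by (auto simp: vec_eq_iff vec_of_list_index simp del: vec_of_list_map)
  then show ?thesis by (auto simp: all_set_conv_all_nth case_prod_unfold)
qed

lemma mat_of_rows_le_iff:
  fixes x :: "real vec"
  assumes "\<And>r b. (r, b) \<in> set rs \<Longrightarrow> r \<in> carrier_vec n"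
  shows "mat_of_rows n (map fst rs) *\<^sub>v x \<le> vec_of_list (map snd rs) \<longleftrightarrow>
    (\<forall>(r, b)\<in>set rs. r \<bullet> x \<le> b)"
proof -
  have "row (mat_of_rows n (map fst rs)) k = fst (rs ! k)" if "k < length rs" for k
    using that assms[of "fst (rs ! k)" "snd (rs ! k)"] by (subst mat_of_rows_row) auto
  then have "mat_of_rows n (map fst rs) *\<^sub>v x \<le> vec_of_list (map snd rs) \<longleftrightarrow>
      (\<forall>k<length rs. fst (rs ! k) \<bullet> x \<le> snd (rs ! k))"
    by (auto simp: less_eq_vec_def vec_of_list_index simp del: vec_of_list_map)
  then show ?thesis by (auto simp: all_set_conv_all_nth case_prod_unfold)
qed

section \<open>Sums of vectors and of quadratic forms\<close>

lemma vsum_carrier [simp]: "vsum n S F \<in> carrier_vec n"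
  by (simp add: vsum_def)

lemma msum_carrier [simp]: "msum n S F \<in> carrier_mat n n"
  by (simp add: msum_def)

lemma row_sq_carrier [simp]: "r \<in> carrier_vec n \<Longrightarrow> row_sq r \<in> carrier_mat n n"
  by (intro carrier_matI) (auto simp: row_sq_def mat_of_row_def)

lemma vsum_scalar_prod:
  assumes "x \<in> carrier_vec n"
  shows "vsum n S F \<bullet> x = (\<Sum>s\<in>S. F s \<bullet> x)"
  using assms by (simp add: vsum_def scalar_prod_def sum_distrib_right) (rule sum.swap)

text \<open>
  In this form a quadratic form is visibly linear in the matrix, which gives its value on sums and
  multiples of matrices.
\<close>

lemma quad_form_entries:
  fixes x :: "real vec"
  assumes "A \<in> carrier_mat n n" and "x \<in> carrier_vec n"
  shows "x \<bullet> (A *\<^sub>v x) = (\<Sum>i<n. \<Sum>j<n. A $$ (i, j) * (x $ i * x $ j))"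
  using assms
  by (auto simp: scalar_prod_def sum_distrib_left lessThan_atLeast0 mult_ac intro!: sum.cong)

lemma quad_form_add:
  fixes x :: "real vec"
  assumes "A \<in> carrier_mat n n" and "B \<in> carrier_mat n n" and "x \<in> carrier_vec n"
  shows "x \<bullet> ((A + B) *\<^sub>v x) = x \<bullet> (A *\<^sub>v x) + x \<bullet> (B *\<^sub>v x)"
  using assms by (simp add: quad_form_entries[where n = n] distrib_right sum.distrib)

lemma quad_form_smult:
  fixes x :: "real vec"
  assumes "A \<in> carrier_mat n n" and "x \<in> carrier_vec n"
  shows "x \<bullet> ((k \<cdot>\<^sub>m A) *\<^sub>v x) = k * (x \<bullet> (A *\<^sub>v x))"
  using assms by (simp add: quad_form_entries[where n = n] sum_distrib_left mult.assoc)

lemma quad_form_msum: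
  assumes "\<And>s. s \<in> S \<Longrightarrow> F s \<in> carrier_mat n n" and "x \<in> carrier_vec n"
  shows "x \<bullet> (msum n S F *\<^sub>v x) = (\<Sum>s\<in>S. x \<bullet> (F s *\<^sub>v x))"
proof -
  have "x \<bullet> (msum n S F *\<^sub>v x) = (\<Sum>i<n. \<Sum>j<n. \<Sum>s\<in>S. F s $$ (i, j) * (x $ i * x $ j))"
    using assms(2) by (subst quad_form_entries[where n = n]) (auto simp: msum_def sum_distrib_right)
  also have "\<dots> = (\<Sum>i<n. \<Sum>s\<in>S. \<Sum>j<n. F s $$ (i, j) * (x $ i * x $ j))"
    by (intro sum.cong refl sum.swap)
  also have "\<dots> = (\<Sum>s\<in>S. \<Sum>i<n. \<Sum>j<n. F s $$ (i, j) * (x $ i * x $ j))"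
    by (rule sum.swap)
  also have "\<dots> = (\<Sum>s\<in>S. x \<bullet> (F s *\<^sub>v x))"
    using assms by (intro sum.cong refl) (simp add: quad_form_entries[where n = n])
  finally show ?thesis .
qed

lemma row_sq_index:
  "i < dim_vec r \<Longrightarrow> j < dim_vec r \<Longrightarrow> row_sq r $$ (i, j) = r $ i * r $ j"
  by (simp add: row_sq_def mat_of_row_def scalar_prod_def)

lemma quad_form_row_sq:
  assumes "r \<in> carrier_vec n" and "x \<in> carrier_vec n"
  shows "x \<bullet> (row_sq r *\<^sub>v x) = (r \<bullet> x)\<^sup>2"
proof -
  have "x \<bullet> (row_sq r *\<^sub>v x) = (\<Sum>i<n. \<Sum>j<n. (r $ i * x $ i) * (r $ j * x $ j))"
    using assms
    by (subst quad_form_entries[where n = n]) (auto simp: row_sq_index mult_ac intro!: sum.cong)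
  also have "\<dots> = (\<Sum>i<n. r $ i * x $ i) * (\<Sum>j<n. r $ j * x $ j)"
    by (rule sum_product[symmetric])
  also have "\<dots> = (r \<bullet> x)\<^sup>2"
    using assms by (simp add: scalar_prod_def power2_eq_square lessThan_atLeast0)
  finally show ?thesis .
qed

lemma transpose_row_sq: "(row_sq r)\<^sup>T = row_sq r"
  by (rule eq_matI) (auto simp: row_sq_def mat_of_row_def scalar_prod_def)

lemma transpose_msum:
  assumes "\<And>s. s \<in> S \<Longrightarrow> F s \<in> carrier_mat n n" and "\<And>s. s \<in> S \<Longrightarrow> (F s)\<^sup>T = F s"
  shows "(msum n S F)\<^sup>T = msum n S F"
proof (rule eq_matI)
  fix i j assume ij: "i < dim_row (msum n S F)" "j < dim_col (msum n S F)"
  have "F s $$ (j, i) = F s $$ (i, j)" if "s \<in> S" for s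
    using assms(1)[OF that] arg_cong[OF assms(2)[OF that], of "\<lambda>A. A $$ (i, j)"] ij
    by (simp add: msum_def)
  then show "(msum n S F)\<^sup>T $$ (i, j) = msum n S F $$ (i, j)"
    using ij by (simp add: msum_def)
qed (simp_all add: msum_def)

lemma transpose_smult: "(k \<cdot>\<^sub>m A)\<^sup>T = k \<cdot>\<^sub>m A\<^sup>T"
  by (rule eq_matI) auto

lemma scalar_prod_self_nonneg: "0 \<le> x \<bullet> (x :: real vec)"
  by (auto simp: scalar_prod_def intro!: sum_nonneg)

lemma scalar_prod_self_pos:
  fixes x :: "real vec"
  assumes "x \<in> carrier_vec n" and "x \<noteq> 0\<^sub>v n"
  shows "0 < x \<bullet> x"
proof -
  obtain k where k: "k < n" "x $ k \<noteq> 0"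
    using assms by (metis carrier_vecD eq_vecI index_zero_vec)
  have "0 < (\<Sum>i\<in>{0..<n}. x $ i * x $ i)"
    using k by (intro sum_pos2[of _ k]) (auto simp: zero_less_mult_iff linorder_neq_iff)
  then show ?thesis using assms(1) by (simp add: scalar_prod_def)
qed

section \<open>Coordinates of the local variables\<close>

lemma set_tm_list: "set (tm_list D) = stages D \<times> scens D"
  by (auto simp: tm_list_def scen_list_def stages_def scens_def)

lemma set_scen_list: "set (scen_list D) = scens D"
  by (auto simp: scen_list_def scens_def)

lemma set_area_list: "set (area_list D) = areas D"
  by (auto simp: area_list_def areas_def)

lemma distinct_area_list: "distinct (area_list D)"
  by (simp add: area_list_def)

lemma sum_area_list: "(\<Sum>i\<leftarrow>area_list D. f i) = (\<Sum>i\<in>areas D. f i)"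
  by (simp add: sum_list_distinct_conv_sum_set distinct_area_list set_area_list)

lemma length_area_list: "length (area_list D) = n_areas D"
  by (simp add: area_list_def)

lemma distinct_tm_list: "distinct (tm_list D)"
  by (simp add: tm_list_def scen_list_def distinct_product)

lemma finite_energy_hours: "finite (energy_hours D)"
proof (rule finite_subset)
  show "energy_hours D \<subseteq> hour_of D ` stages D"
    by (auto simp: energy_hours_def hour_stages_def)
qed (simp add: stages_def)

lemma distinct_concat_map:
  assumes "distinct xs" and "distinct ys" and "\<And>x y x' y'. f x y = f x' y' \<Longrightarrow> x = x' \<and> y = y'"
  shows "distinct (concat (map (\<lambda>x. map (f x) ys) xs))"
  using assms(1)
proof (induction xs)
  case (Cons x xs)
  have "inj_on (f x) (set ys)" using assms(3) by (auto intro: inj_onI)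
  then show ?case
    using Cons assms(2,3) by (auto simp: distinct_map)
qed simp

lemma distinct_if: "distinct (if c then xs else []) \<longleftrightarrow> (c \<longrightarrow> distinct xs)"
  by simp

lemma set_if: "set (if c then xs else []) = {x \<in> set xs. c}"
  by auto

lemma R_row_carrier [simp]: "R_row D i c \<in> carrier_vec (n_loc D i)"
  by (simp add: R_row_def)

lemma dim_R_row [simp]: "dim_vec (R_row D i c) = n_loc D i"
  by (simp add: R_row_def)

context
  fixes D :: "('g::linorder) id_data"
  assumes graph: "graph_conditions D"
begin

lemma line_conditions:
  "lines D \<subseteq> areas D \<times> areas D" "(i, j) \<in> lines D \<Longrightarrow> i \<noteq> j" "(i, j) \<in> lines D \<Longrightarrow> (j, i) \<notin> lines D"
  "finite (units D)"
proof -
  have "\<forall>i j. (i, j) \<in> lines D \<longrightarrow> i \<noteq> j \<and> (j, i) \<notin> lines D"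
    using graph unfolding graph_conditions_def by (elim conjE)
  then show "(i, j) \<in> lines D \<Longrightarrow> i \<noteq> j" "(i, j) \<in> lines D \<Longrightarrow> (j, i) \<notin> lines D"
    by simp_all
  show "lines D \<subseteq> areas D \<times> areas D"
    using graph unfolding graph_conditions_def by (elim conjE)
  show "finite (units D)"
    using graph unfolding graph_conditions_def by (elim conjE)
qed

lemma finite_nbrs: "finite (nbrs D i)"
proof (rule finite_subset)
  show "nbrs D i \<subseteq> areas D"
    using line_conditions(1) by (auto simp: nbrs_def)
qed (simp add: areas_def)

lemma set_nbr_list: "set (nbr_list D i) = nbrs D i"
  by (simp add: nbr_list_def finite_nbrs)

text \<open>
  The enumeration by neighbours hits every line at \<open>i\<close> with its stored orientation because two areas
  are joined by at most one line.
\<close>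

lemma set_inc_list: "set (inc_list D i) = inc_lines D i"
proof (intro subset_antisym subsetI)
  fix e assume "e \<in> set (inc_list D i)"
  then show "e \<in> inc_lines D i"
    by (auto simp: inc_list_def set_nbr_list inc_lines_def nbrs_def)
next
  fix e assume e: "e \<in> inc_lines D i"
  obtain a b where ab: "e = (a, b)" by (cases e)
  have line: "(a, b) \<in> lines D" and "a = i \<or> b = i"
    using e by (auto simp: ab inc_lines_def)
  then consider "a = i" | "b = i" by blast
  then show "e \<in> set (inc_list D i)"
  proof cases
    case 1
    then have "b \<in> nbrs D i" and "e = (if (i, b) \<in> lines D then (i, b) else (b, i))"
      using line by (simp_all add: ab nbrs_def)
    then show ?thesis unfolding inc_list_def set_map set_nbr_list by (rule rev_image_eqI)
  next
    case 2
    then have "a \<in> nbrs D i" and "e = (if (i, a) \<in> lines D then (i, a) else (a, i))"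
      using line line_conditions(3)[OF line] by (simp_all add: ab nbrs_def)
    then show ?thesis unfolding inc_list_def set_map set_nbr_list by (rule rev_image_eqI)
  qed
qed

lemma set_out_list: "set (out_list D i) = out_lines D i"
  by (auto simp: out_list_def set_inc_list out_lines_def inc_lines_def)

text \<open>
  The other end of a line at \<open>i\<close> is the neighbour by which it is enumerated, so no line is listed twice.
\<close>

lemma distinct_inc_list: "distinct (inc_list D i)"
  by (auto simp: inc_list_def distinct_map nbr_list_def inj_on_def split: if_splits)

lemma finite_units_at: "finite (units_at D i)"
  using line_conditions(4) by (simp add: units_at_def)

lemma set_unit_list: "set (unit_list D i) = units_at D i"
  by (simp add: unit_list_def finite_units_at)

lemma self_notin_nbrs: "i \<notin> nbrs D i"
  using line_conditions(2) by (auto simp: nbrs_def)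

text \<open>
  Blocks built from different constructors are disjoint. The only two blocks with the same
  constructor are the own angle and the neighbour angles; they are disjoint since there are no self-loops.
\<close>

lemma distinct_coords: "distinct (coords D i)"
proof -
  have block: "distinct (map f (tm_list D))"
    if "\<And>t m t' m'. f (t, m) = f (t', m') \<Longrightarrow> t = t' \<and> m = m'" for f :: "nat \<times> nat \<Rightarrow> 'g coord"
    using that by (auto simp: distinct_map distinct_tm_list inj_on_def)
  have lists: "distinct (unit_list D i)" "distinct (nbr_list D i)" "distinct (out_list D i)"
      "distinct (scen_list D)"
    by (simp_all add: unit_list_def nbr_list_def out_list_def distinct_inc_list scen_list_def)
  note grid = distinct_concat_map[OF _ distinct_tm_list] distinct_concat_map[OF _ lists(4)]
  show ?thesis
    unfolding coords_def distinct_append distinct_if set_append set_if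
    by (intro conjI impI;
        ((rule block, simp; fail)
        | (rule grid(1), simp add: lists distinct_inc_list, force split: prod.splits; fail)
        | (rule grid(2), simp, simp; fail)
        | (simp add: distinct_map lists inj_on_def; fail)
        | (auto simp: set_nbr_list self_notin_nbrs; fail)))
qed

text \<open>
  If a coordinate is present, distinctness leaves exactly one nonzero entry in its selection row. If it is
  absent, the row vanishes and the value is zero by convention.
\<close>

lemma R_row_scalar_prod:
  assumes "x \<in> carrier_vec (n_loc D i)"
  shows "R_row D i c \<bullet> x = val D i x c"
proof -
  let ?cs = "coords D i"
  have len: "length (list_of_vec x) = length ?cs" 
    using assms by (simp add: n_loc_def)
  have sp: "R_row D i c \<bullet> x = (\<Sum>k<length ?cs. if ?cs ! k = c then x $ k else 0)"
    using assms by (auto simp: R_row_def scalar_prod_def n_loc_def lessThan_atLeast0 intro!: sum.cong)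
  show ?thesis
  proof (cases "c \<in> set ?cs")
    case True
    then obtain k where k: "k < length ?cs" "?cs ! k = c" by (auto simp: in_set_conv_nth)
    have "(\<Sum>l<length ?cs. if ?cs ! l = c then x $ l else 0) = (\<Sum>l<length ?cs. if l = k then x $ l else 0)"
      using k by (intro sum.cong refl) (auto simp: nth_eq_iff_index_eq[OF distinct_coords])
    also have "\<dots> = x $ k" using k by simp
    finally have "R_row D i c \<bullet> x = x $ k" using sp by simp
    moreover have "map_of (zip ?cs (list_of_vec x)) c = Some (list_of_vec x ! k)"
      using map_of_zip_nth[OF len[symmetric] distinct_coords, of k] k len by simp
    ultimately show ?thesis by (simp add: val_def list_of_vec_index)
  next
    case False
    then have "(\<Sum>l<length ?cs. if ?cs ! l = c then x $ l else 0) = 0"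
      by (intro sum.neutral) auto
    moreover have "map_of (zip ?cs (list_of_vec x)) c = None"
      using False len by (simp add: map_of_zip_is_None)
    ultimately show ?thesis using sp by (simp add: val_def)
  qed
qed

text \<open>
  These rules evaluate the scalar product of \<open>x\<^sub>i\<close> with any coefficient row as an expression in the
  named coordinates.
\<close>

lemmas row_products =
  add_scalar_prod_distrib[where n = "n_loc D i"] minus_scalar_prod_distrib[where n = "n_loc D i"]
  smult_scalar_prod_distrib[where n = "n_loc D i"] vsum_scalar_prod[where n = "n_loc D i"]
  R_row_scalar_prod for i

end

section \<open>Local constraints\<close>

lemma ball_set_if: "(\<forall>p\<in>set (if c then xs else []). P p) \<longleftrightarrow> (c \<longrightarrow> (\<forall>p\<in>set xs. P p))"
  by auto

lemma ball_set_concat_map: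
  "(\<forall>p\<in>set (concat (map f xs)). P p) \<longleftrightarrow> (\<forall>x\<in>set xs. \<forall>p\<in>set (f x). P p)"
  by auto

lemma ball_set_map: "(\<forall>p\<in>set (map f xs). P p) \<longleftrightarrow> (\<forall>x\<in>set xs. P (f x))"
  by simp

lemma ball_tm_list: "(\<forall>p\<in>set (tm_list D). P p) \<longleftrightarrow> (\<forall>t\<in>stages D. \<forall>m\<in>scens D. P (t, m))"
  by (auto simp: set_tm_list)

lemma u_vec_eq_iff:
  "u_vec D i x t m = u_vec D i x t m' \<longleftrightarrow>
    (\<forall>p\<in>set (zip (u_coords D i t m) (u_coords D i t m')). val D i x (fst p) = val D i x (snd p))"
proof -
  have len: "length (u_coords D i t m) = length (u_coords D i t m')"
    by (simp add: u_coords_def length_concat comp_def)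
  have "u_vec D i x t m = u_vec D i x t m' \<longleftrightarrow>
      map (val D i x) (u_coords D i t m) = map (val D i x) (u_coords D i t m')"
    unfolding u_vec_def by (metis list_vec)
  also have "\<dots> \<longleftrightarrow> (\<forall>p\<in>set (zip (u_coords D i t m) (u_coords D i t m')).
      val D i x (fst p) = val D i x (snd p))"
    using len by (induction rule: list_induct2) auto
  finally show ?thesis .
qed

text \<open>
  Scenario 1 is the reference through which any two scenarios are compared.
\<close>

lemma nonanticipativity_iff:
  "(\<forall>m\<in>scens D. \<forall>m'\<in>scens D. u_vec D i x 0 m = u_vec D i x 0 m') \<longleftrightarrow>
    (\<forall>m\<in>{2..<Suc (n_scen D)}. \<forall>p\<in>set (zip (u_coords D i 0 m) (u_coords D i 0 1)).
       val D i x (fst p) = val D i x (snd p))"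
  unfolding u_vec_eq_iff[symmetric]
proof (intro iffI ballI)
  fix m assume "\<forall>m\<in>scens D. \<forall>m'\<in>scens D. u_vec D i x 0 m = u_vec D i x 0 m'"
    and "m \<in> {2..<Suc (n_scen D)}"
  then show "u_vec D i x 0 m = u_vec D i x 0 1" by (auto simp: scens_def)
next
  fix m m' assume first: "\<forall>m\<in>{2..<Suc (n_scen D)}. u_vec D i x 0 m = u_vec D i x 0 1"
    and "m \<in> scens D" "m' \<in> scens D"
  have "u_vec D i x 0 k = u_vec D i x 0 1" if "k \<in> scens D" for k
    using first that by (cases "k = 1") (auto simp: scens_def)
  then show "u_vec D i x 0 m = u_vec D i x 0 m'"
    using \<open>m \<in> scens D\<close> \<open>m' \<in> scens D\<close> by metis
qed

context
  fixes D :: "('g::linorder) id_data"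
  assumes graph: "graph_conditions D"
begin

text \<open>
  A property of all rows of a concatenated list becomes a conjunction with one member for each group of
  constraints, in the order of the list.
\<close>

lemmas ball_row_list = set_append ball_Un ball_set_if ball_set_concat_map ball_set_map ball_tm_list
  prod.case set_scen_list set_inc_list[OF graph] set_out_list[OF graph] set_unit_list[OF graph]

text \<open>
  The right-hand side follows the list of rows group by group, so that the groups can be compared
  separately; in each of them only terms are moved across the equality sign.
\<close>

lemma eq_rows_iff:
  assumes x: "x \<in> carrier_vec (n_loc D i)"
  defines "y \<equiv> val D i x"
  shows "(\<forall>(r, b)\<in>set (eq_rows D i). r \<bullet> x = b) \<longleftrightarrow>
    (\<forall>t\<in>stages D. \<forall>m\<in>scens D.
       y (Conv t m) + (\<Sum>g\<in>units_at D i. y (Gen g t m) - y (Pump g t m))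
         + y (Discharge t m) - y (Charge t m) + y (Res t m) + y (Reg t m)
         - (\<Sum>e\<in>inc_lines D i. line_sgn i e * y (Flow e t m)) = P_mot D i t m) \<and>
    (\<forall>e\<in>inc_lines D i. \<forall>t\<in>stages D. \<forall>m\<in>scens D.
       y (Flow e t m) = line_sgn i e * line_B D e * (y (Angle i t m) - y (Angle (other_end i e) t m))) \<and>
    (i \<in> batt_areas D \<longrightarrow>
      (\<forall>t\<in>stages D. \<forall>m\<in>scens D. y (Energy (t + 1) m)
         = y (Energy t m) + dt * (eta_c D i * y (Charge t m) - y (Discharge t m) / eta_d D i)) \<and>
      (\<forall>m\<in>scens D. y (Energy 0 m) = E_init D i)) \<and>
    (i \<in> conv_areas D \<longrightarrow>
      (\<forall>t\<in>stages D. \<forall>m\<in>scens D. y (Conv t m) = y (QPlus t m) - y (QMinus t m)) \<and>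
      (\<forall>h\<in>energy_hours D. \<forall>m\<in>scens D.
         dt * (\<Sum>t\<in>hour_stages D h. y (Conv t m)) = e_DA D i h - e_past D i h)) \<and>
    (\<forall>m\<in>{2..<Suc (n_scen D)}. \<forall>p\<in>set (zip (u_coords D i 0 m) (u_coords D i 0 1)).
       y (fst p) = y (snd p))"
  unfolding eq_rows_def balance_row_def ball_row_list y_def set_upt
    set_sorted_list_of_set[OF finite_energy_hours]
  by (intro arg_cong2[where f = "(\<and>)"] ball_cong imp_cong refl;
      simp add: row_products[OF graph, where i = i] x case_prod_unfold divide_inverse algebra_simps; fail)

text \<open>
  As for the equalities, group by group. The two signed rows of a ramp limit, and the two bounds of a
  line limit, combine into an absolute value.
\<close>

lemma in_rows_iff:
  assumes x: "x \<in> carrier_vec (n_loc D i)"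
  defines "y \<equiv> val D i x"
  shows "(\<forall>(r, b)\<in>set (in_rows D i). r \<bullet> x \<le> b) \<longleftrightarrow>
    ((\<forall>t\<in>stages D. \<forall>m\<in>scens D. 0 \<le> y (Reg t m) \<and> y (Reg t m) \<le> P_av D i t m) \<and>
     (\<forall>e\<in>inc_lines D i. \<forall>t\<in>stages D. \<forall>m\<in>scens D. \<bar>y (Flow e t m)\<bar> \<le> line_P D e) \<and>
     (i \<in> batt_areas D \<longrightarrow>
       (\<forall>s\<in>{0..<Suc (horizon D)}. \<forall>m\<in>scens D.
          E_min D i \<le> y (Energy s m) \<and> y (Energy s m) \<le> E_max D i) \<and>
       (\<forall>t\<in>stages D. \<forall>m\<in>scens D. 0 \<le> y (Charge t m) \<and> y (Charge t m) \<le> P_bmax D i) \<and>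
       (\<forall>t\<in>stages D. \<forall>m\<in>scens D. 0 \<le> y (Discharge t m) \<and> y (Discharge t m) \<le> P_bmax D i)) \<and>
     (i \<in> conv_areas D \<longrightarrow>
       (\<forall>t\<in>stages D. \<forall>m\<in>scens D. 0 \<le> y (QPlus t m)) \<and>
       (\<forall>t\<in>stages D. \<forall>m\<in>scens D. 0 \<le> y (QMinus t m)) \<and>
       (\<forall>t\<in>stages D. \<forall>m\<in>scens D. delta_DA D i (hour_of D t) * P_cvmin D i \<le> y (Conv t m) \<and>
          y (Conv t m) \<le> delta_DA D i (hour_of D t) * P_cvmax D i) \<and>
       (\<forall>m\<in>scens D. 0 \<le> y (Peak m))) \<and>
     (\<forall>g\<in>units_at D i. \<forall>t\<in>stages D. \<forall>m\<in>scens D.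
        0 \<le> y (Gen g t m) \<and> y (Gen g t m) \<le> P_gmax D g t m) \<and>
     (\<forall>g\<in>units_at D i. \<forall>t\<in>stages D. \<forall>m\<in>scens D.
        0 \<le> y (Pump g t m) \<and> y (Pump g t m) \<le> P_pmax D g t m) \<and>
     (i \<in> ren_areas D \<longrightarrow>
       (\<forall>t\<in>stages D. \<forall>m\<in>scens D. 0 \<le> y (Res t m) \<and> y (Res t m) \<le> P_resmax D i t m))) \<and>
    (i \<in> batt_areas D \<longrightarrow> (\<forall>m\<in>scens D. E_term D i \<le> y (Energy (horizon D) m))) \<and>
    (i \<in> conv_areas D \<longrightarrow>
      (\<forall>m\<in>scens D. \<bar>y (Conv 0 m) - p_prev D i\<bar> \<le> P_ramp D i) \<and>
      (\<forall>t\<in>{1..<horizon D}. \<forall>m\<in>scens D. \<bar>y (Conv t m) - y (Conv (t - 1) m)\<bar> \<le> P_ramp D i) \<and>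
      (\<forall>t\<in>stages D. \<forall>m\<in>scens D. y (QPlus t m) - p_peak D i \<le> y (Peak m))) \<and>
    (\<forall>e\<in>out_lines D i. \<forall>t\<in>stages D. \<forall>m\<in>scens D. \<forall>k\<in>{1..<Suc (n_cuts D)}.
       cut_a D e k * y (Flow e t m) + cut_b D e k \<le> y (Loss e t m))"
  unfolding in_rows_def bounds_def bound_rows_def ball_row_list y_def option.case list.set ball_simps set_upt
  by (intro arg_cong2[where f = "(\<and>)"] ball_cong imp_cong refl;
      ((simp add: row_products[OF graph, where i = i] x carrier_vecD[OF x] abs_le_iff algebra_simps; fail)
      | (auto simp: row_products[OF graph, where i = i] x carrier_vecD[OF x] abs_le_iff; fail)))

lemma local_feasible_iff:
  assumes x: "x \<in> carrier_vec (n_loc D i)"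
  shows "x \<in> local_feasible D i \<longleftrightarrow>
    (\<forall>(r, b)\<in>set (eq_rows D i). r \<bullet> x = b) \<and> (\<forall>(r, b)\<in>set (in_rows D i). r \<bullet> x \<le> b)"
proof -
  define y where "y = val D i x"
  \<comment> \<open>Quantifiers are pushed to the atomic constraints. Then both sides are Boolean combinations of the
     same quantified formulas, and the equivalence is propositional.\<close>
  have later: "(\<forall>t\<in>stages D. t \<ge> 1 \<longrightarrow> P t) \<longleftrightarrow> (\<forall>t\<in>{1..<horizon D}. P t)" for P
    by (auto simp: stages_def)
  have interval: "{a..b} = {a..<Suc b}" for a b :: nat
    by auto
  have network: "network_constraints D i y \<longleftrightarrow>
    (\<forall>t\<in>stages D. \<forall>m\<in>scens D. 0 \<le> y (Reg t m) \<and> y (Reg t m) \<le> P_av D i t m) \<and>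
    (\<forall>t\<in>stages D. \<forall>m\<in>scens D.
       y (Conv t m) + (\<Sum>g\<in>units_at D i. y (Gen g t m) - y (Pump g t m))
         + y (Discharge t m) - y (Charge t m) + y (Res t m) + y (Reg t m)
         - (\<Sum>e\<in>inc_lines D i. line_sgn i e * y (Flow e t m)) = P_mot D i t m) \<and>
    (\<forall>e\<in>inc_lines D i. \<forall>t\<in>stages D. \<forall>m\<in>scens D.
       y (Flow e t m) = line_sgn i e * line_B D e * (y (Angle i t m) - y (Angle (other_end i e) t m))) \<and>
    (\<forall>e\<in>inc_lines D i. \<forall>t\<in>stages D. \<forall>m\<in>scens D. \<bar>y (Flow e t m)\<bar> \<le> line_P D e) \<and>
    (\<forall>e\<in>out_lines D i. \<forall>t\<in>stages D. \<forall>m\<in>scens D. \<forall>k\<in>{1..<Suc (n_cuts D)}.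
       cut_a D e k * y (Flow e t m) + cut_b D e k \<le> y (Loss e t m))"
    unfolding network_constraints_def interval by blast
  have battery: "battery_constraints D i y \<longleftrightarrow>
    (\<forall>m\<in>scens D. y (Energy 0 m) = E_init D i) \<and>
    (\<forall>t\<in>stages D. \<forall>m\<in>scens D. y (Energy (t + 1) m)
       = y (Energy t m) + dt * (eta_c D i * y (Charge t m) - y (Discharge t m) / eta_d D i)) \<and>
    (\<forall>t\<in>stages D. \<forall>m\<in>scens D. 0 \<le> y (Charge t m) \<and> y (Charge t m) \<le> P_bmax D i) \<and>
    (\<forall>t\<in>stages D. \<forall>m\<in>scens D. 0 \<le> y (Discharge t m) \<and> y (Discharge t m) \<le> P_bmax D i) \<and>
    (\<forall>s\<in>{0..<Suc (horizon D)}. \<forall>m\<in>scens D.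
       E_min D i \<le> y (Energy s m) \<and> y (Energy s m) \<le> E_max D i) \<and>
    (\<forall>m\<in>scens D. E_term D i \<le> y (Energy (horizon D) m))"
    unfolding battery_constraints_def interval by blast
  have converter: "converter_constraints D i y \<longleftrightarrow>
    (\<forall>t\<in>stages D. \<forall>m\<in>scens D. y (Conv t m) = y (QPlus t m) - y (QMinus t m)) \<and>
    (\<forall>h\<in>energy_hours D. \<forall>m\<in>scens D.
       dt * (\<Sum>t\<in>hour_stages D h. y (Conv t m)) = e_DA D i h - e_past D i h) \<and>
    (\<forall>t\<in>stages D. \<forall>m\<in>scens D. 0 \<le> y (QPlus t m)) \<and>
    (\<forall>t\<in>stages D. \<forall>m\<in>scens D. 0 \<le> y (QMinus t m)) \<and>
    (\<forall>t\<in>stages D. \<forall>m\<in>scens D. delta_DA D i (hour_of D t) * P_cvmin D i \<le> y (Conv t m) \<and>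
       y (Conv t m) \<le> delta_DA D i (hour_of D t) * P_cvmax D i) \<and>
    (\<forall>m\<in>scens D. 0 \<le> y (Peak m)) \<and>
    (\<forall>m\<in>scens D. \<bar>y (Conv 0 m) - p_prev D i\<bar> \<le> P_ramp D i) \<and>
    (\<forall>t\<in>{1..<horizon D}. \<forall>m\<in>scens D. \<bar>y (Conv t m) - y (Conv (t - 1) m)\<bar> \<le> P_ramp D i) \<and>
    (\<forall>t\<in>stages D. \<forall>m\<in>scens D. y (QPlus t m) - p_peak D i \<le> y (Peak m))"
    unfolding converter_constraints_def later by blast
  have unit: "unit_constraints D i y \<longleftrightarrow>
    (\<forall>g\<in>units_at D i. \<forall>t\<in>stages D. \<forall>m\<in>scens D.
       0 \<le> y (Gen g t m) \<and> y (Gen g t m) \<le> P_gmax D g t m) \<and>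
    (\<forall>g\<in>units_at D i. \<forall>t\<in>stages D. \<forall>m\<in>scens D.
       0 \<le> y (Pump g t m) \<and> y (Pump g t m) \<le> P_pmax D g t m)"
    unfolding unit_constraints_def by blast
  have "x \<in> local_feasible D i \<longleftrightarrow>
     network_constraints D i y \<and>
     (i \<in> batt_areas D \<longrightarrow> battery_constraints D i y) \<and>
     (i \<in> conv_areas D \<longrightarrow> converter_constraints D i y) \<and>
     unit_constraints D i y \<and>
     (i \<in> ren_areas D \<longrightarrow> renewable_constraints D i y) \<and>
     (\<forall>m\<in>scens D. \<forall>m'\<in>scens D. u_vec D i x 0 m = u_vec D i x 0 m')"
    using x by (simp add: local_feasible_def y_def)
  then show ?thesis
    unfolding network battery converter unit renewable_constraints_def nonanticipativity_iff
      eq_rows_iff[OF x, folded y_def] in_rows_iff[OF x, folded y_def] y_def[symmetric]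
    by argo
qed

end

section \<open>The local objective as a quadratic function\<close>

text \<open>
  The cost and its matrix form are both brought into this shape and then compared for one stage and one
  scenario at a time.
\<close>

definition expected_sum :: "'g id_data \<Rightarrow> (nat \<Rightarrow> nat \<Rightarrow> real) \<Rightarrow> real" where
  "expected_sum D h = (\<Sum>m\<in>scens D. prob D m * (\<Sum>t\<in>stages D. h t m))"

lemma expected_sum_add:
  "expected_sum D h + expected_sum D k = expected_sum D (\<lambda>t m. h t m + k t m)"
  by (simp add: expected_sum_def sum.distrib distrib_left)

lemma expected_sum_cmult: "c * expected_sum D h = expected_sum D (\<lambda>t m. c * h t m)"
  by (simp add: expected_sum_def sum_distrib_left mult.left_commute)

lemma val_absent:
  assumes "c \<notin> set (coords D i)"
  shows "val D i x c = 0"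
proof -
  have "c \<notin> set (map fst (zip (coords D i) (list_of_vec x)))"
    using assms by (auto dest: set_zip_leftD)
  then have "map_of (zip (coords D i) (list_of_vec x)) c = None"
    unfolding map_of_eq_None_iff by simp
  then show ?thesis by (simp add: val_def)
qed

text \<open>
  The cost guards the terms of an asset by its presence, whereas the matrix and vector
  of the objective contain them for every area.
  The two agree because the coordinates of an absent asset have value zero.
\<close>

lemma val_absent_asset:
  "i \<notin> conv_areas D \<Longrightarrow> val D i x (QPlus t m) = 0"
  "i \<notin> conv_areas D \<Longrightarrow> val D i x (QMinus t m) = 0"
  "i \<notin> conv_areas D \<Longrightarrow> val D i x (Peak m) = 0"
  "i \<notin> batt_areas D \<Longrightarrow> val D i x (Charge t m) = 0"
  "i \<notin> batt_areas D \<Longrightarrow> val D i x (Discharge t m) = 0"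
  "i \<notin> batt_areas D \<Longrightarrow> val D i x (Energy t m) = 0"
  "i \<notin> ren_areas D \<Longrightarrow> val D i x (Res t m) = 0"
  by (rule val_absent; auto simp: coords_def split: if_splits)+

lemma Q_loc_carrier: "Q_loc D i \<in> carrier_mat (n_loc D i) (n_loc D i)"
  by (simp add: Q_loc_def Let_def)

context
  fixes D :: "('g::linorder) id_data"
  assumes graph: "graph_conditions D"
begin

lemma quad_form_Q_loc:
  assumes x: "x \<in> carrier_vec (n_loc D i)"
  defines "y \<equiv> val D i x"
  shows "x \<bullet> (Q_loc D i *\<^sub>v x) = eps D i * (x \<bullet> x) + expected_sum D (\<lambda>t m.
    w_soc D i * (y (Energy (t + 1) m))\<^sup>2
    + dt * (\<Sum>g\<in>units_at D i. cost_a D g t * (y (Gen g t m) - y (Pump g t m))\<^sup>2))"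
proof -
  have one: "1\<^sub>m (n_loc D i) *\<^sub>v x = x" using x by simp
  show ?thesis
    unfolding Q_loc_def Let_def expected_sum_def
    by (simp add: quad_form_add[where n = "n_loc D i"] quad_form_smult[where n = "n_loc D i"]
        quad_form_msum[where n = "n_loc D i"] quad_form_row_sq[where n = "n_loc D i"]
        minus_scalar_prod_distrib[where n = "n_loc D i"]
        R_row_scalar_prod[OF graph] R_row_carrier x one y_def)
qed

text \<open>
  The peak cost is charged at every stage; since the peak slack does not depend on the stage, the sum over
  the stages gives the factor \<open>H\<close> in \<open>q\<^sub>i\<close>.
\<close>

lemma q_loc_scalar_prod:
  assumes x: "x \<in> carrier_vec (n_loc D i)"
  defines "y \<equiv> val D i x"
  shows "q_loc D i \<bullet> x = expected_sum D (\<lambda>t m.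
      dt * (price_E D i t * y (QPlus t m) - price_Ex D i t * y (QMinus t m)
        + cost_b D i * (y (Charge t m) + y (Discharge t m))
        - cost_ct D i * y (Res t m) - cost_rg D i * y (Reg t m)
        + (\<Sum>g\<in>units_at D i. cost_g D g t * y (Gen g t m) + cost_p D g t * y (Pump g t m))
        + cost_ls D * (\<Sum>e\<in>out_lines D i. y (Loss e t m)))
      - w_soc D i * E_ref D i (t + 1) * y (Energy (t + 1) m) + cost_pk D * y (Peak m))"
proof -
  have peak: "real (horizon D) * cost_pk D * (\<Sum>m\<in>scens D. prob D m * y (Peak m))
      = expected_sum D (\<lambda>t m. cost_pk D * y (Peak m))"
    by (simp add: expected_sum_def stages_def sum_distrib_left mult_ac)
  have "q_loc D i \<bullet> x = expected_sum D (\<lambda>t m.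
      dt * (price_E D i t * y (QPlus t m) - price_Ex D i t * y (QMinus t m)
        + cost_b D i * (y (Charge t m) + y (Discharge t m))
        - cost_ct D i * y (Res t m) - cost_rg D i * y (Reg t m)
        + (\<Sum>g\<in>units_at D i. cost_g D g t * y (Gen g t m) + cost_p D g t * y (Pump g t m))
        + cost_ls D * (\<Sum>e\<in>out_lines D i. y (Loss e t m)))
      - w_soc D i * E_ref D i (t + 1) * y (Energy (t + 1) m))
    + real (horizon D) * cost_pk D * (\<Sum>m\<in>scens D. prob D m * y (Peak m))"
    unfolding q_loc_def Let_def expected_sum_def
    by (simp add: row_products[OF graph, where i = i] R_row_carrier x y_def)
  then show ?thesis unfolding peak expected_sum_add .
qed

text \<open>
  The remainder collects what is left when the squares of the state-of-charge deviations and the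
  unused renewable and regulation power are expanded: it contains data only.
\<close>

lemma local_cost_eq:
  assumes x: "x \<in> carrier_vec (n_loc D i)"
  shows "local_cost D i x = 1 / 2 * (x \<bullet> (Q_loc D i *\<^sub>v x)) + q_loc D i \<bullet> x
    + expected_sum D (\<lambda>t m.
        (if i \<in> ren_areas D then dt * cost_ct D i * P_resmax D i t m else 0)
        + dt * cost_rg D i * P_av D i t m
        + (if i \<in> batt_areas D then w_soc D i / 2 * (E_ref D i (t + 1))\<^sup>2 else 0))"
proof -
  define y where "y = val D i x"
  have soc: "(if i \<in> batt_areas D then w_soc D i / 2 * (\<Sum>m\<in>scens D. prob D m *
        (\<Sum>t\<in>stages D. (y (Energy (t + 1) m) - E_ref D i (t + 1))\<^sup>2)) else 0)
      = expected_sum D (\<lambda>t m. if i \<in> batt_areas D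
          then w_soc D i / 2 * (y (Energy (t + 1) m) - E_ref D i (t + 1))\<^sup>2 else 0)"
    unfolding expected_sum_def[symmetric] expected_sum_cmult by (simp add: expected_sum_def)
  have pointwise: "stage_cost D i y t m + (\<Sum>e\<in>out_lines D i. cost_ls D * y (Loss e t m) * dt)
      + (if i \<in> batt_areas D then w_soc D i / 2 * (y (Energy (t + 1) m) - E_ref D i (t + 1))\<^sup>2 else 0)
    = 1 / 2 * (w_soc D i * (y (Energy (t + 1) m))\<^sup>2
        + dt * (\<Sum>g\<in>units_at D i. cost_a D g t * (y (Gen g t m) - y (Pump g t m))\<^sup>2))
      + (dt * (price_E D i t * y (QPlus t m) - price_Ex D i t * y (QMinus t m)
          + cost_b D i * (y (Charge t m) + y (Discharge t m))
          - cost_ct D i * y (Res t m) - cost_rg D i * y (Reg t m)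
          + (\<Sum>g\<in>units_at D i. cost_g D g t * y (Gen g t m) + cost_p D g t * y (Pump g t m))
          + cost_ls D * (\<Sum>e\<in>out_lines D i. y (Loss e t m)))
        - w_soc D i * E_ref D i (t + 1) * y (Energy (t + 1) m) + cost_pk D * y (Peak m))
      + ((if i \<in> ren_areas D then dt * cost_ct D i * P_resmax D i t m else 0)
        + dt * cost_rg D i * P_av D i t m
        + (if i \<in> batt_areas D then w_soc D i / 2 * (E_ref D i (t + 1))\<^sup>2 else 0))" for t m
  proof -
    have units: "(\<Sum>g\<in>units_at D i. cost_g D g t * y (Gen g t m) + cost_p D g t * y (Pump g t m)
          + cost_a D g t / 2 * (y (Gen g t m) - y (Pump g t m))\<^sup>2)
        = (\<Sum>g\<in>units_at D i. cost_g D g t * y (Gen g t m) + cost_p D g t * y (Pump g t m))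
          + 1 / 2 * (\<Sum>g\<in>units_at D i. cost_a D g t * (y (Gen g t m) - y (Pump g t m))\<^sup>2)"
      by (simp add: sum.distrib sum_distrib_left)
    have loss: "(\<Sum>e\<in>out_lines D i. cost_ls D * y (Loss e t m) * dt)
        = dt * (cost_ls D * (\<Sum>e\<in>out_lines D i. y (Loss e t m)))"
      by (simp add: sum_distrib_left mult_ac)
    have conv: "(if i \<in> conv_areas D then
          dt * (price_E D i t * y (QPlus t m) - price_Ex D i t * y (QMinus t m)) + cost_pk D * y (Peak m)
        else 0)
      = dt * (price_E D i t * y (QPlus t m) - price_Ex D i t * y (QMinus t m)) + cost_pk D * y (Peak m)"
      by (simp add: y_def val_absent_asset)
    have batt: "(if i \<in> batt_areas D then dt * cost_b D i * (y (Charge t m) + y (Discharge t m)) else 0)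
      = dt * cost_b D i * (y (Charge t m) + y (Discharge t m))"
      by (simp add: y_def val_absent_asset)
    have energy: "(if i \<in> batt_areas D
          then w_soc D i / 2 * (y (Energy (t + 1) m) - E_ref D i (t + 1))\<^sup>2 else 0)
      = w_soc D i / 2 * (y (Energy (t + 1) m))\<^sup>2 - w_soc D i * E_ref D i (t + 1) * y (Energy (t + 1) m)
        + (if i \<in> batt_areas D then w_soc D i / 2 * (E_ref D i (t + 1))\<^sup>2 else 0)"
      by (simp add: y_def val_absent_asset power2_diff algebra_simps)
    have ren: "(if i \<in> ren_areas D then dt * cost_ct D i * (P_resmax D i t m - y (Res t m)) else 0)
      = (if i \<in> ren_areas D then dt * cost_ct D i * P_resmax D i t m else 0)
        - dt * cost_ct D i * y (Res t m)"
      by (simp add: y_def val_absent_asset algebra_simps)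
    show ?thesis
      unfolding stage_cost_def units loss conv batt energy ren
      by (simp add: algebra_simps)
  qed
  have "local_cost D i x = expected_sum D (\<lambda>t m.
      stage_cost D i y t m + (\<Sum>e\<in>out_lines D i. cost_ls D * y (Loss e t m) * dt)
      + (if i \<in> batt_areas D then w_soc D i / 2 * (y (Energy (t + 1) m) - E_ref D i (t + 1))\<^sup>2 else 0))
    + eps D i / 2 * (x \<bullet> x)"
    unfolding local_cost_def Let_def y_def[symmetric] soc expected_sum_add[symmetric]
    by (simp add: expected_sum_def sum.distrib distrib_left)
  then show ?thesis
    unfolding pointwise quad_form_Q_loc[OF x] q_loc_scalar_prod[OF x] y_def[symmetric]
      expected_sum_add[symmetric] expected_sum_cmult[symmetric]
    by (simp add: algebra_simps)
qed

lemma transpose_Q_loc: "(Q_loc D i)\<^sup>T = Q_loc D i"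
proof -
  let ?n = "n_loc D i"
  have add: "(A + B)\<^sup>T = A + B" if "A\<^sup>T = A" "B\<^sup>T = B" "A \<in> carrier_mat ?n ?n" "B \<in> carrier_mat ?n ?n"
    for A B :: "real mat"
    using that by (simp add: transpose_add[where nr = ?n and nc = ?n])
  show ?thesis
    unfolding Q_loc_def Let_def
    by (intro add transpose_msum)
      (simp_all add: transpose_smult transpose_row_sq transpose_msum[where n = ?n]
        transpose_add[where nr = ?n and nc = ?n])
qed

text \<open>
  All other terms of the form are nonnegative multiples of squares. The weight \<open>w\<^sup>s\<^sup>o\<^sup>c\<close> is known to be
  nonnegative only at areas with a battery; elsewhere the energy coordinate is zero.
\<close>

lemma quad_form_Q_loc_ge:
  assumes "economic_conditions D" and "i \<in> areas D" and x: "x \<in> carrier_vec (n_loc D i)"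
  shows "eps D i * (x \<bullet> x) \<le> x \<bullet> (Q_loc D i *\<^sub>v x)"
proof -
  define y where "y = val D i x"
  note econ = assms(1)[unfolded economic_conditions_def]
  have soc: "0 \<le> w_soc D i * (y (Energy (t + 1) m))\<^sup>2" for t m
    using econ by (cases "i \<in> batt_areas D") (auto simp: y_def val_absent_asset)
  have units: "0 \<le> (\<Sum>g\<in>units_at D i. cost_a D g t * (y (Gen g t m) - y (Pump g t m))\<^sup>2)"
    if "t \<in> stages D" for t m
    using econ that by (intro sum_nonneg mult_nonneg_nonneg) (auto simp: units_at_def)
  have stage: "0 \<le> w_soc D i * (y (Energy (t + 1) m))\<^sup>2
      + dt * (\<Sum>g\<in>units_at D i. cost_a D g t * (y (Gen g t m) - y (Pump g t m))\<^sup>2)"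
    if "t \<in> stages D" for t m
    using soc units[OF that] by (intro add_nonneg_nonneg mult_nonneg_nonneg[of dt]) (auto simp: dt_def)
  have "0 \<le> prob D m" if "m \<in> scens D" for m
    using econ that by (auto intro: less_imp_le)
  then have "0 \<le> expected_sum D (\<lambda>t m. w_soc D i * (y (Energy (t + 1) m))\<^sup>2
      + dt * (\<Sum>g\<in>units_at D i. cost_a D g t * (y (Gen g t m) - y (Pump g t m))\<^sup>2))"
    unfolding expected_sum_def by (intro sum_nonneg mult_nonneg_nonneg stage)
  then show ?thesis
    unfolding quad_form_Q_loc[OF x] y_def by simp
qed

end

section \<open>The consensus constraints\<close>

text \<open>
  Row \<open>k\<close> of \<open>Z\<^sub>a\<close> has its only nonzero entry in the column with quotient \<open>a - 1\<close> and remainder \<open>k\<close>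
  modulo \<open>HM\<close>, because areas are counted from 1 and blocks from 0.
\<close>

lemma Z_mat_mult_vec:
  assumes "a \<in> areas D" and "\<And>b. b \<in> areas D \<Longrightarrow> z b \<in> carrier_vec (HM D)"
  shows "Z_mat D a *\<^sub>v col_vecs (map z (area_list D)) = z a"
proof (rule eq_vecI)
  let ?w = "col_vecs (map z (area_list D))"
  have dim: "dim_vec ?w = n_areas D * HM D"
  proof -
    have "(\<Sum>i\<leftarrow>area_list D. dim_vec (z i)) = (\<Sum>i\<in>areas D. HM D)"
      unfolding sum_area_list using assms(2) by (intro sum.cong) auto
    then show ?thesis by (simp add: dim_col_vecs comp_def areas_def)
  qed
  show "dim_vec (Z_mat D a *\<^sub>v ?w) = dim_vec (z a)"
    using assms(2)[OF assms(1)] by (simp add: Z_mat_def)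
  fix k assume "k < dim_vec (z a)"
  then have k: "k < HM D" using assms(2)[OF assms(1)] by simp
  let ?l = "(a - 1) * HM D + k"
  have a: "1 \<le> a" "a \<le> n_areas D" using assms(1) by (auto simp: areas_def)
  have "Suc (a - 1) * HM D \<le> n_areas D * HM D" using a by (intro mult_right_mono) auto
  then have l: "?l < n_areas D * HM D" using k by simp
  have "(Z_mat D a *\<^sub>v ?w) $ k = (\<Sum>j<n_areas D * HM D.
      unit_vec (n_areas D) (a - 1) $ (j div HM D) * 1\<^sub>m (HM D) $$ (k, j mod HM D) * ?w $ j)"
    using k by (simp add: Z_mat_def scalar_prod_def dim lessThan_atLeast0)
  also have "\<dots> = (\<Sum>j<n_areas D * HM D. if j = ?l then ?w $ j else 0)"
  proof (rule sum.cong[OF refl])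
    fix j assume "j \<in> {..<n_areas D * HM D}"
    then have "j div HM D < n_areas D" by (simp add: less_mult_imp_div_less)
    moreover have "j mod HM D < HM D" using k by simp
    moreover have "j = ?l \<longleftrightarrow> j div HM D = a - 1 \<and> j mod HM D = k"
    proof
      show "j = ?l \<Longrightarrow> j div HM D = a - 1 \<and> j mod HM D = k" using k by simp
      show "j div HM D = a - 1 \<and> j mod HM D = k \<Longrightarrow> j = ?l"
        using div_mult_mod_eq[of j "HM D"] by metis
    qed
    ultimately show "unit_vec (n_areas D) (a - 1) $ (j div HM D) * 1\<^sub>m (HM D) $$ (k, j mod HM D) * ?w $ j
        = (if j = ?l then ?w $ j else 0)"
      using k by (auto simp: unit_vec_def)
  qed
  also have "\<dots> = ?w $ ?l" using l by simp
  also have "\<dots> = map z (area_list D) ! (a - 1) $ k"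
    using a assms(2) k
    by (intro col_vecs_index) (auto simp: length_area_list set_area_list)
  also have "map z (area_list D) ! (a - 1) = z a"
    using a by (simp add: area_list_def nth_upt del: upt_Suc)
  finally show "(Z_mat D a *\<^sub>v ?w) $ k = z a $ k" .
qed

text \<open>
  The blocks are grouped by areas, to match the shape in which the consensus rows of the local variables
  appear.
\<close>

lemma Z_hat_mult_vec:
  fixes D :: "('g::linorder) id_data"
  assumes "graph_conditions D" and "\<And>b. b \<in> areas D \<Longrightarrow> z b \<in> carrier_vec (HM D)"
  shows "Z_hat D *\<^sub>v col_vecs (map z (area_list D))
    = col_vecs (map (\<lambda>i. col_vecs (map z (i # nbr_list D i))) (area_list D))"
proof -
  let ?w = "col_vecs (map z (area_list D))"
  \<comment> \<open>A neighbour is again an area, so every index that occurs selects a block of the stack.\<close>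
  have select: "map (\<lambda>a. Z_mat D a *\<^sub>v ?w) (i # nbr_list D i) = map z (i # nbr_list D i)"
    if "i \<in> areas D" for i
  proof -
    have sub: "set (i # nbr_list D i) \<subseteq> areas D"
      using that line_conditions(1)[OF assms(1)] by (auto simp: set_nbr_list[OF assms(1)] nbrs_def)
    show ?thesis
    proof (rule map_cong[OF refl])
      fix a assume "a \<in> set (i # nbr_list D i)"
      with sub have "a \<in> areas D" by (rule subsetD)
      then show "Z_mat D a *\<^sub>v ?w = z a" by (rule Z_mat_mult_vec) (rule assms(2))
    qed
  qed
  have "Z_hat D *\<^sub>v ?w = col_vecs (map (\<lambda>A. A *\<^sub>v ?w)
      (concat (map (\<lambda>i. map (Z_mat D) (i # nbr_list D i)) (area_list D))))"
    unfolding Z_hat_def by (rule vstack_mult_vec) (auto simp: Z_mat_def)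
  also have "\<dots> = col_vecs (map (\<lambda>i. col_vecs (map (\<lambda>a. Z_mat D a *\<^sub>v ?w) (i # nbr_list D i))) (area_list D))"
    unfolding map_concat col_vecs_concat map_map comp_def ..
  also have "map (\<lambda>i. col_vecs (map (\<lambda>a. Z_mat D a *\<^sub>v ?w) (i # nbr_list D i))) (area_list D)
      = map (\<lambda>i. col_vecs (map z (i # nbr_list D i))) (area_list D)"
    by (rule map_cong[OF refl]) (simp only: set_area_list select)
  finally show ?thesis .
qed

lemma S_mat_dim: "dim_row (S_mat D i a) = HM D" "dim_col (S_mat D i a) = n_loc D i"
  by (simp_all add: S_mat_def tm_list_def scen_list_def HM_def)

lemma S_hat_mult_vec:
  assumes "\<And>i. i \<in> areas D \<Longrightarrow> x i \<in> carrier_vec (n_loc D i)"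
  shows "S_hat D *\<^sub>v col_vecs (map x (area_list D))
    = col_vecs (map (\<lambda>i. col_vecs (map (\<lambda>a. S_mat D i a *\<^sub>v x i) (i # nbr_list D i))) (area_list D))"
proof -
  let ?A = "\<lambda>i. vstack (n_loc D i) (map (S_mat D i) (i # nbr_list D i))"
  have "S_hat D *\<^sub>v col_vecs (map x (area_list D)) = col_vecs (map (\<lambda>i. ?A i *\<^sub>v x i) (area_list D))"
    unfolding S_hat_def by (rule mult_diag_block_mat_vec) (simp add: set_area_list carrier_vecD[OF assms])
  also have "(\<lambda>i. ?A i *\<^sub>v x i) = (\<lambda>i. col_vecs (map (\<lambda>a. S_mat D i a *\<^sub>v x i) (i # nbr_list D i)))"
    by (subst vstack_mult_vec) (auto simp: S_mat_dim comp_def)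
  finally show ?thesis .
qed

section \<open>The stacked quadratic program\<close>

lemma block_dims:
  "dim_row (D_eq D) = (\<Sum>i\<in>areas D. dim_vec (b_eq_loc D i))" "dim_col (D_eq D) = (\<Sum>i\<in>areas D. n_loc D i)"
  "dim_row (D_in D) = (\<Sum>i\<in>areas D. dim_vec (b_in_loc D i))" "dim_col (D_in D) = (\<Sum>i\<in>areas D. n_loc D i)"
  "dim_row (S_hat D) = HM D * (\<Sum>i\<in>areas D. 1 + card (nbrs D i))" "dim_col (S_hat D) = (\<Sum>i\<in>areas D. n_loc D i)"
  "dim_row (Z_hat D) = HM D * (\<Sum>i\<in>areas D. 1 + card (nbrs D i))" "dim_col (Z_hat D) = n_areas D * HM D"
proof -
  have len: "length (nbr_list D i) = card (nbrs D i)" for i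
    by (simp add: nbr_list_def)
  show "dim_row (D_eq D) = (\<Sum>i\<in>areas D. dim_vec (b_eq_loc D i))"
    by (simp add: D_eq_def dim_diag_block_mat comp_def A_eq_loc_def b_eq_loc_def sum_area_list)
  show "dim_col (D_eq D) = (\<Sum>i\<in>areas D. n_loc D i)"
    by (simp add: D_eq_def dim_diag_block_mat comp_def A_eq_loc_def sum_area_list)
  show "dim_row (D_in D) = (\<Sum>i\<in>areas D. dim_vec (b_in_loc D i))"
    by (simp add: D_in_def dim_diag_block_mat comp_def A_in_loc_def b_in_loc_def sum_area_list)
  show "dim_col (D_in D) = (\<Sum>i\<in>areas D. n_loc D i)"
    by (simp add: D_in_def dim_diag_block_mat comp_def A_in_loc_def sum_area_list)
  show "dim_row (S_hat D) = HM D * (\<Sum>i\<in>areas D. 1 + card (nbrs D i))"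
    by (simp add: S_hat_def dim_diag_block_mat comp_def S_mat_dim sum_area_list sum_list_triv len
        sum_distrib_left distrib_left mult.commute)
  show "dim_col (S_hat D) = (\<Sum>i\<in>areas D. n_loc D i)"
    by (simp add: S_hat_def dim_diag_block_mat comp_def sum_area_list)
  have "(\<Sum>A\<leftarrow>concat (map (\<lambda>i. map (Z_mat D) (i # nbr_list D i)) (area_list D)). dim_row A)
      = (\<Sum>i\<leftarrow>area_list D. \<Sum>a\<leftarrow>i # nbr_list D i. HM D)"
    unfolding sum_list_map_concat map_map comp_def by (simp add: Z_mat_def)
  then show "dim_row (Z_hat D) = HM D * (\<Sum>i\<in>areas D. 1 + card (nbrs D i))"
    by (simp add: Z_hat_def sum_area_list sum_list_triv len sum_distrib_left distrib_left mult.commute)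
  show "dim_col (Z_hat D) = n_areas D * HM D"
    by (simp add: Z_hat_def)
qed

lemma stacked_parts_carrier:
  assumes "(x, z) \<in> ID_space D"
  shows "col_vecs (map x (area_list D)) \<in> carrier_vec (\<Sum>i\<in>areas D. n_loc D i)"
    and "col_vecs (map z (area_list D)) \<in> carrier_vec (n_areas D * HM D)"
proof -
  have xz: "dim_vec (x i) = n_loc D i" "dim_vec (z i) = HM D" if "i \<in> areas D" for i
    using assms that by (auto simp: ID_space_def PiE_iff)
  show "col_vecs (map x (area_list D)) \<in> carrier_vec (\<Sum>i\<in>areas D. n_loc D i)"
    by (rule carrier_vecI) (simp add: dim_col_vecs comp_def sum_area_list xz)
  have "(\<Sum>i\<in>areas D. dim_vec (z i)) = (\<Sum>i\<in>areas D. HM D)"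
    by (intro sum.cong refl xz)
  then show "col_vecs (map z (area_list D)) \<in> carrier_vec (n_areas D * HM D)"
    by (intro carrier_vecI) (simp add: dim_col_vecs comp_def sum_area_list areas_def)
qed

lemma stack_eq: "stack D (x, z) = col_vecs (map x (area_list D)) @\<^sub>v col_vecs (map z (area_list D))"
  by (simp add: stack_def col_vecs_append)

text \<open>
  Families are undefined outside the set of areas, so the blocks of a stacked vector determine them
  completely; conversely any vector of the right dimension can be cut into blocks.
\<close>

lemma bij_betw_stack: "bij_betw (stack D) (ID_space D) (carrier_vec (n_tot D))"
proof (rule bij_betw_imageI)
  show "inj_on (stack D) (ID_space D)"
  proof (rule inj_onI, clarify)
    fix x z x' z' assume xz: "(x, z) \<in> ID_space D" and xz': "(x', z') \<in> ID_space D"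
      and "stack D (x, z) = stack D (x', z')"
    then have "col_vecs (map x (area_list D)) = col_vecs (map x' (area_list D))"
        "col_vecs (map z (area_list D)) = col_vecs (map z' (area_list D))"
      unfolding stack_eq append_vec_eq[OF stacked_parts_carrier(1)[OF xz] stacked_parts_carrier(1)[OF xz']] by simp_all
    moreover have "dim_vec (x i) = dim_vec (x' i)" "dim_vec (z i) = dim_vec (z' i)"
      if "i \<in> set (area_list D)" for i
      using xz xz' that by (auto simp: ID_space_def PiE_iff set_area_list)
    ultimately have "\<forall>i\<in>areas D. x i = x' i" "\<forall>i\<in>areas D. z i = z' i"
      using col_vecs_eq_iff[of "area_list D" x x'] col_vecs_eq_iff[of "area_list D" z z']
      by (simp_all add: set_area_list)
    then show "x = x' \<and> z = z'"
      using xz xz' by (auto simp: ID_space_def intro: PiE_ext)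
  qed
  show "stack D ` ID_space D = carrier_vec (n_tot D)"
  proof (intro subset_antisym subsetI)
    fix v assume "v \<in> stack D ` ID_space D"
    then obtain x z where "(x, z) \<in> ID_space D" "v = stack D (x, z)" by auto
    then show "v \<in> carrier_vec (n_tot D)"
      unfolding stack_eq n_tot_def by (auto intro!: append_carrier_vec stacked_parts_carrier)
  next
    fix v :: "real vec" assume v: "v \<in> carrier_vec (n_tot D)"
    let ?n = "\<Sum>i\<in>areas D. n_loc D i" and ?m = "n_areas D * HM D"
    have "vec_first v ?n \<in> carrier_vec (\<Sum>i\<leftarrow>area_list D. n_loc D i)"
      by (simp add: sum_area_list)
    then obtain x where x: "x \<in> (\<Pi>\<^sub>E i\<in>set (area_list D). carrier_vec (n_loc D i))"
        "col_vecs (map x (area_list D)) = vec_first v ?n"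
      by (rule col_vecs_surj[OF distinct_area_list])
    have "vec_last v ?m \<in> carrier_vec (\<Sum>i\<leftarrow>area_list D. HM D)"
      by (simp add: sum_area_list areas_def)
    then obtain z where z: "z \<in> (\<Pi>\<^sub>E i\<in>set (area_list D). carrier_vec (HM D))"
        "col_vecs (map z (area_list D)) = vec_last v ?m"
      by (rule col_vecs_surj[OF distinct_area_list])
    have "stack D (x, z) = v"
      using v unfolding stack_eq x(2) z(2) n_tot_def by (rule vec_first_last_append)
    moreover have "(x, z) \<in> ID_space D"
      using x(1) z(1) by (simp add: ID_space_def set_area_list)
    ultimately show "v \<in> stack D ` ID_space D" by (metis imageI)
  qed
qed

text \<open>
  The right-hand side is bracketed like the rows of the equality matrix.
\<close>

lemma b_eq_split: "b_eq D = (col_vecs (map (b_eq_loc D) (area_list D))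
    @\<^sub>v 0\<^sub>v (HM D * (\<Sum>i\<in>areas D. 1 + card (nbrs D i)))) @\<^sub>v 0\<^sub>v (HM D)"
proof -
  have "b_eq D = col_vecs ((map (b_eq_loc D) (area_list D)
      @ [0\<^sub>v (HM D * (\<Sum>i\<in>areas D. 1 + card (nbrs D i)))]) @ [0\<^sub>v (HM D)])"
    by (simp add: b_eq_def)
  then show ?thesis unfolding col_vecs_append by simp
qed

lemma A_eq_carrier: "A_eq D \<in> carrier_mat (dim_vec (b_eq D)) (n_tot D)"
  by (rule carrier_matI)
    (simp_all add: A_eq_def append_rows_def b_eq_split n_tot_def block_dims dim_col_vecs comp_def
      sum_area_list Z_mat_def)

lemma A_in_carrier: "A_in D \<in> carrier_mat (dim_vec (b_in D)) (n_tot D)"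
  by (rule carrier_matI)
    (simp_all add: A_in_def b_in_def n_tot_def block_dims dim_col_vecs comp_def sum_area_list)

lemma A_eq_iff:
  assumes X: "X \<in> carrier_vec (\<Sum>i\<in>areas D. n_loc D i)" and Z: "Z \<in> carrier_vec (n_areas D * HM D)"
  shows "A_eq D *\<^sub>v (X @\<^sub>v Z) = b_eq D \<longleftrightarrow>
    D_eq D *\<^sub>v X = col_vecs (map (b_eq_loc D) (area_list D)) \<and>
    S_hat D *\<^sub>v X = Z_hat D *\<^sub>v Z \<and> Z_mat D (ref_area D) *\<^sub>v Z = 0\<^sub>v (HM D)"
proof -
  let ?n = "\<Sum>i\<in>areas D. n_loc D i" and ?m = "n_areas D * HM D"
    and ?p = "HM D * (\<Sum>i\<in>areas D. 1 + card (nbrs D i))"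
  \<comment> \<open>The local rows and the consensus rows form one block matrix; the reference row is below it.\<close>
  let ?top = "four_block_mat (D_eq D) (0\<^sub>m (dim_row (D_eq D)) ?m) (S_hat D) (- Z_hat D)"
  let ?bottom = "four_block_mat (0\<^sub>m (HM D) ?n) (Z_mat D (ref_area D)) (0\<^sub>m 0 ?n) (0\<^sub>m 0 ?m)"
  have Deq: "D_eq D \<in> carrier_mat (dim_row (D_eq D)) ?n"
    and S: "S_hat D \<in> carrier_mat ?p ?n" and Zh: "Z_hat D \<in> carrier_mat ?p ?m"
    and Zr: "Z_mat D (ref_area D) \<in> carrier_mat (HM D) ?m"
    by (auto simp: block_dims Z_mat_def)
  then have mZh: "- Z_hat D \<in> carrier_mat ?p ?m"
    by (simp only: uminus_carrier_iff_mat)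
  have "A_eq D *\<^sub>v (X @\<^sub>v Z) = ?top *\<^sub>v (X @\<^sub>v Z) @\<^sub>v ?bottom *\<^sub>v (X @\<^sub>v Z)"
    unfolding A_eq_def
    by (rule mat_mult_append[where nc = "?n + ?m"], rule four_block_carrier_mat[OF Deq, of _ ?p],
        use Zh in simp, rule four_block_carrier_mat[of _ "HM D" _ _ 0], use X Z in auto)
  also have "?top *\<^sub>v (X @\<^sub>v Z)
      = (D_eq D *\<^sub>v X + 0\<^sub>m (dim_row (D_eq D)) ?m *\<^sub>v Z) @\<^sub>v (S_hat D *\<^sub>v X + (- Z_hat D) *\<^sub>v Z)"
    by (rule four_block_mat_mult_vec[OF Deq zero_carrier_mat S mZh X Z])
  also have "D_eq D *\<^sub>v X + 0\<^sub>m (dim_row (D_eq D)) ?m *\<^sub>v Z = D_eq D *\<^sub>v X"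
    unfolding zero_mat_mult_vec[OF Z] by (rule right_zero_vec) (rule mult_mat_vec_carrier[OF Deq X])
  also have "?bottom *\<^sub>v (X @\<^sub>v Z) = 0\<^sub>m (HM D) ?n *\<^sub>v X + Z_mat D (ref_area D) *\<^sub>v Z"
    by (rule block_row_mult_vec[OF zero_carrier_mat Zr X Z])
  also have "\<dots> = Z_mat D (ref_area D) *\<^sub>v Z"
    unfolding zero_mat_mult_vec[OF X] by (rule left_zero_vec) (rule mult_mat_vec_carrier[OF Zr Z])
  finally have "A_eq D *\<^sub>v (X @\<^sub>v Z)
      = (D_eq D *\<^sub>v X @\<^sub>v (S_hat D *\<^sub>v X + (- Z_hat D) *\<^sub>v Z)) @\<^sub>v Z_mat D (ref_area D) *\<^sub>v Z" .
  moreover have "D_eq D *\<^sub>v X \<in> carrier_vec (dim_row (D_eq D))"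
    using Deq X by (rule mult_mat_vec_carrier)
  moreover have b: "col_vecs (map (b_eq_loc D) (area_list D)) \<in> carrier_vec (dim_row (D_eq D))"
    by (rule carrier_vecI) (simp add: block_dims dim_col_vecs comp_def sum_area_list)
  moreover have "S_hat D *\<^sub>v X + (- Z_hat D) *\<^sub>v Z \<in> carrier_vec ?p"
    by (rule add_carrier_vec[OF mult_mat_vec_carrier[OF S X] mult_mat_vec_carrier[OF mZh Z]])
  ultimately have "A_eq D *\<^sub>v (X @\<^sub>v Z) = b_eq D \<longleftrightarrow>
      D_eq D *\<^sub>v X = col_vecs (map (b_eq_loc D) (area_list D)) \<and>
      S_hat D *\<^sub>v X + (- Z_hat D) *\<^sub>v Z = 0\<^sub>v ?p \<and> Z_mat D (ref_area D) *\<^sub>v Z = 0\<^sub>v (HM D)"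
    unfolding b_eq_split by (simp add: append_vec_eq[where n = "dim_row (D_eq D) + ?p"]
        append_vec_eq[where n = "dim_row (D_eq D)"])
  moreover have "S_hat D *\<^sub>v X + (- Z_hat D) *\<^sub>v Z = 0\<^sub>v ?p \<longleftrightarrow> S_hat D *\<^sub>v X = Z_hat D *\<^sub>v Z"
    using S Zh Z by (auto simp: vec_eq_iff)
  ultimately show ?thesis by simp
qed

text \<open>
  The quadratic program has one block for each area and a last one for all of \<open>z\<close>. Indexing the blocks by
  \<open>Some i\<close> and \<open>None\<close> makes them families over one list, to which the rules for
  block-diagonal matrices apply.
\<close>

lemma block_families:
  fixes D :: "('g::linorder) id_data" and x z :: "nat \<Rightarrow> real vec"
  defines "l \<equiv> map Some (area_list D) @ [None]" and "m \<equiv> n_areas D * HM D"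
    and "Z \<equiv> col_vecs (map z (area_list D))"
  shows "stack D (x, z) = col_vecs (map (case_option Z x) l)"
    and "Q_mat D = diag_block_mat (map (case_option (0\<^sub>m m m) (Q_loc D)) l)"
    and "q_vec D = col_vecs (map (case_option (0\<^sub>v m) (q_loc D)) l)"
  by (simp_all add: l_def m_def Z_def stack_eq col_vecs_append Q_mat_def q_vec_def comp_def)

lemma Q_mat_carrier: "Q_mat D \<in> carrier_mat (n_tot D) (n_tot D)"
proof -
  have "dim_row (Q_loc D i) = n_loc D i" "dim_col (Q_loc D i) = n_loc D i" for i
    using Q_loc_carrier[of D i] by auto
  then show ?thesis
    by (intro carrier_matI) (simp_all add: Q_mat_def dim_diag_block_mat comp_def sum_area_list n_tot_def)
qed

lemma q_vec_carrier: "q_vec D \<in> carrier_vec (n_tot D)"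
proof -
  have "dim_vec (q_loc D i) = n_loc D i" for i
    by (simp add: q_loc_def Let_def vsum_def)
  then show ?thesis
    by (intro carrier_vecI) (simp add: q_vec_def dim_col_vecs comp_def sum_area_list n_tot_def)
qed

context
  fixes D :: "('g::linorder) id_data"
  assumes graph: "graph_conditions D"
begin

lemma local_feasible_matrix_iff:
  assumes x: "x \<in> carrier_vec (n_loc D i)"
  shows "x \<in> local_feasible D i \<longleftrightarrow>
    A_eq_loc D i *\<^sub>v x = b_eq_loc D i \<and> A_in_loc D i *\<^sub>v x \<le> b_in_loc D i"
proof -
  have eq: "\<forall>p\<in>set (eq_rows D i). fst p \<in> carrier_vec (n_loc D i)"
    unfolding eq_rows_def balance_row_def ball_row_list[OF graph] by (auto simp: case_prod_unfold)
  have ineq: "\<forall>p\<in>set (in_rows D i). fst p \<in> carrier_vec (n_loc D i)"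
    unfolding in_rows_def bounds_def bound_rows_def ball_row_list[OF graph] option.case by simp
  have "A_eq_loc D i *\<^sub>v x = b_eq_loc D i \<longleftrightarrow> (\<forall>(r, b)\<in>set (eq_rows D i). r \<bullet> x = b)"
    unfolding A_eq_loc_def b_eq_loc_def by (rule mat_of_rows_eq_iff) (use eq in fastforce)
  moreover have "A_in_loc D i *\<^sub>v x \<le> b_in_loc D i \<longleftrightarrow> (\<forall>(r, b)\<in>set (in_rows D i). r \<bullet> x \<le> b)"
    unfolding A_in_loc_def b_in_loc_def by (rule mat_of_rows_le_iff) (use ineq in fastforce)
  ultimately show ?thesis
    using local_feasible_iff[OF graph x] by (simp only:)
qed

lemma ID_feasible_iff:
  assumes xz: "(x, z) \<in> ID_space D"
  shows "(x, z) \<in> ID_feasible D \<longleftrightarrow>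
    stack D (x, z) \<in> qp_feasible (n_tot D) (A_eq D) (b_eq D) (A_in D) (b_in D)"
proof -
  let ?X = "col_vecs (map x (area_list D))" and ?Z = "col_vecs (map z (area_list D))"
  let ?l = "area_list D"
  note XZ = stacked_parts_carrier[OF xz]
  have x: "x i \<in> carrier_vec (n_loc D i)" and z: "z i \<in> carrier_vec (HM D)" if "i \<in> areas D" for i
    using xz that by (auto simp: ID_space_def PiE_iff)
  have "ref_area D \<in> areas D"
    using graph unfolding graph_conditions_def by (elim conjE)
  then have ref: "Z_mat D (ref_area D) *\<^sub>v ?Z = z (ref_area D)"
    by (rule Z_mat_mult_vec) (rule z)
  have "D_eq D *\<^sub>v ?X = col_vecs (map (\<lambda>i. A_eq_loc D i *\<^sub>v x i) ?l)"
    unfolding D_eq_def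
    by (rule mult_diag_block_mat_vec) (simp add: set_area_list carrier_vecD[OF x] A_eq_loc_def)
  then have eq: "D_eq D *\<^sub>v ?X = col_vecs (map (b_eq_loc D) ?l) \<longleftrightarrow>
      (\<forall>i\<in>areas D. A_eq_loc D i *\<^sub>v x i = b_eq_loc D i)"
    by (simp add: col_vecs_eq_iff A_eq_loc_def b_eq_loc_def set_area_list)
  have "A_in D *\<^sub>v (?X @\<^sub>v ?Z) = D_in D *\<^sub>v ?X + 0\<^sub>m (dim_row (D_in D)) (n_areas D * HM D) *\<^sub>v ?Z"
    unfolding A_in_def using XZ by (intro block_row_mult_vec) (auto simp: block_dims)
  also have "\<dots> = D_in D *\<^sub>v ?X"
    unfolding zero_mat_mult_vec[OF XZ(2)] by (rule right_zero_vec, rule carrier_vecI) simp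
  also have "\<dots> = col_vecs (map (\<lambda>i. A_in_loc D i *\<^sub>v x i) ?l)"
    unfolding D_in_def
    by (rule mult_diag_block_mat_vec) (simp add: set_area_list carrier_vecD[OF x] A_in_loc_def)
  finally have ineq: "A_in D *\<^sub>v (?X @\<^sub>v ?Z) \<le> b_in D \<longleftrightarrow>
      (\<forall>i\<in>areas D. A_in_loc D i *\<^sub>v x i \<le> b_in_loc D i)"
    by (simp add: b_in_def col_vecs_le_iff A_in_loc_def b_in_loc_def set_area_list)
  have nbrs: "nbrs D i \<subseteq> areas D" for i
    using line_conditions(1)[OF graph] by (auto simp: nbrs_def)
  have consensus: "S_hat D *\<^sub>v ?X = Z_hat D *\<^sub>v ?Z \<longleftrightarrow>
      (\<forall>i\<in>areas D. \<forall>a\<in>insert i (nbrs D i). S_mat D i a *\<^sub>v x i = z a)"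
  proof -
    have dim: "dim_vec (S_mat D i a *\<^sub>v x i) = dim_vec (z a)" if "i \<in> areas D" "a \<in> set (i # nbr_list D i)" for i a
    proof -
      have "a \<in> areas D" using that nbrs by (auto simp: set_nbr_list[OF graph])
      then show ?thesis by (simp add: S_mat_dim carrier_vecD[OF z])
    qed
    have SX: "S_hat D *\<^sub>v ?X = col_vecs (map (\<lambda>i. col_vecs (map (\<lambda>a. S_mat D i a *\<^sub>v x i) (i # nbr_list D i))) ?l)"
      by (rule S_hat_mult_vec) (rule x)
    have ZZ: "Z_hat D *\<^sub>v ?Z = col_vecs (map (\<lambda>i. col_vecs (map z (i # nbr_list D i))) ?l)"
      by (rule Z_hat_mult_vec[OF graph]) (rule z)
    have "S_hat D *\<^sub>v ?X = Z_hat D *\<^sub>v ?Z \<longleftrightarrow> (\<forall>i\<in>set ?l.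
        col_vecs (map (\<lambda>a. S_mat D i a *\<^sub>v x i) (i # nbr_list D i)) = col_vecs (map z (i # nbr_list D i)))"
      unfolding SX ZZ
    proof (rule col_vecs_eq_iff)
      fix i assume "i \<in> set ?l"
      then have i: "i \<in> areas D" by (simp only: set_area_list)
      show "dim_vec (col_vecs (map (\<lambda>a. S_mat D i a *\<^sub>v x i) (i # nbr_list D i)))
          = dim_vec (col_vecs (map z (i # nbr_list D i)))"
        unfolding dim_col_vecs map_map comp_def
        by (rule arg_cong[where f = sum_list], rule map_cong[OF refl]) (rule dim[OF i])
    qed
    also have "\<dots> \<longleftrightarrow> (\<forall>i\<in>areas D. \<forall>a\<in>set (i # nbr_list D i). S_mat D i a *\<^sub>v x i = z a)"
      unfolding set_area_list by (rule ball_cong[OF refl], rule col_vecs_eq_iff) (rule dim)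
    finally show ?thesis by (simp add: set_nbr_list[OF graph])
  qed
  have "stack D (x, z) \<in> carrier_vec (n_tot D)"
    using bij_betw_stack xz by (metis bij_betw_apply)
  then have "stack D (x, z) \<in> qp_feasible (n_tot D) (A_eq D) (b_eq D) (A_in D) (b_in D) \<longleftrightarrow>
      (\<forall>i\<in>areas D. A_eq_loc D i *\<^sub>v x i = b_eq_loc D i) \<and>
      (\<forall>i\<in>areas D. \<forall>a\<in>insert i (nbrs D i). S_mat D i a *\<^sub>v x i = z a) \<and>
      z (ref_area D) = 0\<^sub>v (HM D) \<and>
      (\<forall>i\<in>areas D. A_in_loc D i *\<^sub>v x i \<le> b_in_loc D i)"
    unfolding qp_feasible_def mem_Collect_eq stack_eq A_eq_iff[OF XZ] eq ineq consensus ref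
    by (simp only: conj_assoc simp_thms)
  moreover have "(x, z) \<in> ID_feasible D \<longleftrightarrow>
      (\<forall>i\<in>areas D. A_eq_loc D i *\<^sub>v x i = b_eq_loc D i \<and> A_in_loc D i *\<^sub>v x i \<le> b_in_loc D i) \<and>
      (\<forall>i\<in>areas D. \<forall>a\<in>insert i (nbrs D i). S_mat D i a *\<^sub>v x i = z a) \<and>
      z (ref_area D) = 0\<^sub>v (HM D)"
    using xz unfolding ID_feasible_def
    by (simp only: mem_Collect_eq prod.case simp_thms local_feasible_matrix_iff[OF x] cong: ball_cong)
  ultimately show ?thesis by (simp only: ball_conj_distrib) argo
qed

lemma qp_terms_stack:
  assumes xz: "(x, z) \<in> ID_space D"
  shows "stack D (x, z) \<bullet> (Q_mat D *\<^sub>v stack D (x, z)) = (\<Sum>i\<in>areas D. x i \<bullet> (Q_loc D i *\<^sub>v x i))"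
    and "q_vec D \<bullet> stack D (x, z) = (\<Sum>i\<in>areas D. q_loc D i \<bullet> x i)"
proof -
  let ?l = "map Some (area_list D) @ [None]" and ?m = "n_areas D * HM D"
  let ?Z = "col_vecs (map z (area_list D))"
  let ?x = "case_option ?Z x" and ?Q = "case_option (0\<^sub>m ?m ?m) (Q_loc D)"
    and ?q = "case_option (0\<^sub>v ?m) (q_loc D)"
  note Z = stacked_parts_carrier(2)[OF xz]
  have x: "x i \<in> carrier_vec (n_loc D i)" if "i \<in> areas D" for i
    using xz that by (auto simp: ID_space_def PiE_iff)
  have Q: "dim_row (Q_loc D i) = n_loc D i" "dim_col (Q_loc D i) = n_loc D i"
    and q: "dim_vec (q_loc D i) = n_loc D i" for i
    using Q_loc_carrier[of D i] by (auto simp: q_loc_def Let_def vsum_def)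
  have "Q_mat D *\<^sub>v stack D (x, z) = col_vecs (map (\<lambda>b. ?Q b *\<^sub>v ?x b) ?l)"
    unfolding block_families(1)[of D x z] block_families(2)
    by (rule mult_diag_block_mat_vec) (auto simp: set_area_list carrier_vecD[OF x] carrier_vecD[OF Z] Q)
  then have "stack D (x, z) \<bullet> (Q_mat D *\<^sub>v stack D (x, z)) = (\<Sum>b\<leftarrow>?l. ?x b \<bullet> (?Q b *\<^sub>v ?x b))"
    unfolding block_families(1)
    by (simp only:, intro scalar_prod_col_vecs)
      (auto simp: set_area_list carrier_vecD[OF x] carrier_vecD[OF Z] Q)
  also have "\<dots> = (\<Sum>i\<in>areas D. x i \<bullet> (Q_loc D i *\<^sub>v x i))"
    using Z by (simp add: comp_def sum_area_list zero_mat_mult_vec)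
  finally show "stack D (x, z) \<bullet> (Q_mat D *\<^sub>v stack D (x, z)) = (\<Sum>i\<in>areas D. x i \<bullet> (Q_loc D i *\<^sub>v x i))" .
  have "q_vec D \<bullet> stack D (x, z) = (\<Sum>b\<leftarrow>?l. ?q b \<bullet> ?x b)"
    unfolding block_families(1)[of D x z] block_families(3)
    by (rule scalar_prod_col_vecs) (auto simp: set_area_list carrier_vecD[OF x] carrier_vecD[OF Z] q)
  also have "\<dots> = (\<Sum>i\<in>areas D. q_loc D i \<bullet> x i)"
    using Z by (simp add: comp_def sum_area_list)
  finally show "q_vec D \<bullet> stack D (x, z) = (\<Sum>i\<in>areas D. q_loc D i \<bullet> x i)" .
qed

lemma ID_objective_eq:
  "\<exists>c. \<forall>xz\<in>ID_space D. ID_objective D xz = qp_objective (Q_mat D) (q_vec D) (stack D xz) + c"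
proof -
  define c where "c = (\<Sum>i\<in>areas D. expected_sum D (\<lambda>t m.
      (if i \<in> ren_areas D then dt * cost_ct D i * P_resmax D i t m else 0)
      + dt * cost_rg D i * P_av D i t m
      + (if i \<in> batt_areas D then w_soc D i / 2 * (E_ref D i (t + 1))\<^sup>2 else 0)))"
  have "ID_objective D (x, z) = qp_objective (Q_mat D) (q_vec D) (stack D (x, z)) + c"
    if xz: "(x, z) \<in> ID_space D" for x z
  proof -
    have x: "x i \<in> carrier_vec (n_loc D i)" if "i \<in> areas D" for i
      using xz that by (auto simp: ID_space_def PiE_iff)
    show ?thesis
      unfolding ID_objective_def prod.case qp_objective_def qp_terms_stack[OF xz] c_def
      by (simp add: local_cost_eq[OF graph x] sum.distrib sum_distrib_left cong: sum.cong)
  qed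
  then show ?thesis by fast
qed

lemma transpose_Q_mat: "(Q_mat D)\<^sup>T = Q_mat D"
  unfolding Q_mat_def
  by (rule transpose_diag_block_mat) (auto simp: transpose_Q_loc[OF graph])

text \<open>
  Since stacking is onto, it is enough to evaluate the form on stacked families, where it is the
  sum of the local forms.
\<close>

lemma Q_mat_sym_psd:
  assumes econ: "economic_conditions D"
  shows "sym_psd (n_tot D) (Q_mat D)"
  unfolding sym_psd_def
proof (intro conjI ballI Q_mat_carrier transpose_Q_mat)
  fix v :: "real vec" assume "v \<in> carrier_vec (n_tot D)"
  then have "v \<in> stack D ` ID_space D"
    by (simp only: bij_betw_imp_surj_on[OF bij_betw_stack])
  then obtain x z where xz: "(x, z) \<in> ID_space D" and v: "v = stack D (x, z)"
    by auto
  have "0 \<le> x i \<bullet> (Q_loc D i *\<^sub>v x i)" if i: "i \<in> areas D" for i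
  proof -
    have "0 \<le> eps D i" using econ i by (simp add: economic_conditions_def)
    then have "0 \<le> eps D i * (x i \<bullet> x i)" using scalar_prod_self_nonneg by simp
    also have "\<dots> \<le> x i \<bullet> (Q_loc D i *\<^sub>v x i)"
      using xz i by (intro quad_form_Q_loc_ge[OF graph econ]) (auto simp: ID_space_def PiE_iff)
    finally show ?thesis .
  qed
  then show "0 \<le> v \<bullet> (Q_mat D *\<^sub>v v)"
    unfolding v qp_terms_stack[OF xz] by (rule sum_nonneg)
qed

lemma Q_loc_sym_pd:
  assumes "economic_conditions D" and i: "i \<in> areas D" and "eps D i > 0"
  shows "sym_pd (n_loc D i) (Q_loc D i)"
  unfolding sym_pd_def
proof (intro conjI ballI impI Q_loc_carrier transpose_Q_loc[OF graph])
  fix v :: "real vec" assume v: "v \<in> carrier_vec (n_loc D i)" "v \<noteq> 0\<^sub>v (n_loc D i)"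
  then have "0 < eps D i * (v \<bullet> v)"
    using assms(3) scalar_prod_self_pos by simp
  also have "\<dots> \<le> v \<bullet> (Q_loc D i *\<^sub>v v)"
    by (rule quad_form_Q_loc_ge[OF graph assms(1) i v(1)])
  finally show "0 < v \<bullet> (Q_loc D i *\<^sub>v v)" .
qed

end

theorem theorem13:
  fixes D :: "('g::linorder) id_data"
  assumes "standing_conditions D"
  shows "convex_qp (n_tot D) (Q_mat D) (q_vec D) (A_eq D) (b_eq D) (A_in D) (b_in D) \<and>
    bij_betw (stack D) (ID_space D) (carrier_vec (n_tot D)) \<and>
    (\<forall>xz\<in>ID_space D. xz \<in> ID_feasible D \<longleftrightarrow>
       stack D xz \<in> qp_feasible (n_tot D) (A_eq D) (b_eq D) (A_in D) (b_in D)) \<and>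
    (\<exists>c. \<forall>xz\<in>ID_space D.
       ID_objective D xz = qp_objective (Q_mat D) (q_vec D) (stack D xz) + c) \<and>
    ((\<forall>i\<in>areas D. eps D i > 0) \<longrightarrow> (\<forall>i\<in>areas D. sym_pd (n_loc D i) (Q_loc D i)))"
proof -
  have graph: "graph_conditions D" and econ: "economic_conditions D"
    using assms by (simp_all add: standing_conditions_def)
  show ?thesis
  proof (intro conjI)
    show "convex_qp (n_tot D) (Q_mat D) (q_vec D) (A_eq D) (b_eq D) (A_in D) (b_in D)"
      unfolding convex_qp_def
      using Q_mat_sym_psd[OF graph econ] q_vec_carrier A_eq_carrier A_in_carrier
      by blast
    show "bij_betw (stack D) (ID_space D) (carrier_vec (n_tot D))"
      by (rule bij_betw_stack)
    show "\<forall>xz\<in>ID_space D. xz \<in> ID_feasible D \<longleftrightarrow>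
       stack D xz \<in> qp_feasible (n_tot D) (A_eq D) (b_eq D) (A_in D) (b_in D)"
      using ID_feasible_iff[OF graph] by fast
    show "\<exists>c. \<forall>xz\<in>ID_space D. ID_objective D xz = qp_objective (Q_mat D) (q_vec D) (stack D xz) + c"
      by (rule ID_objective_eq[OF graph])
    show "(\<forall>i\<in>areas D. eps D i > 0) \<longrightarrow> (\<forall>i\<in>areas D. sym_pd (n_loc D i) (Q_loc D i))"
      using Q_loc_sym_pd[OF graph econ] by blast
  qed
qed

end
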